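(* Let $F$, $T$, $V$ be Thompson's groups. For a group $G\in\{F,T,V\}$ and a subset $S$ (with $S=[0,1/2]$ or $S=[0,1/2)$) put $G_S=\{g\in G \mid g \text{ is the identity on } S\}$. Then each of the pairs $(F,F_{[0,1/2]})$, $(T,T_{[0,1/2]})$ and $(V,V_{[0,1/2)})$ has infinitely many ends, i.e. $e(F,F_{[0,1/2]})=e(T,T_{[0,1/2]})=e(V,V_{[0,1/2)})=\infty$.
   Context: Thompson's group $F$ is the group of piecewise linear homeomorphisms $h$ of $[0,1]$ such that $h$ fails to be differentiable at only finitely many points, all of them dyadic rational numbers, and at every other point $x\in[0,1]$ one has $h'(x)\in\{2^i\mid i\in\mathbb{Z}\}$. Thompson's group $T$ is the analogous group of homeomorphisms of the circle $[0,1]/(0\sim 1)$: piecewise linear orientation-preserving homeomorphisms that map (images of) dyadic rationals to dyadic rationals, are differentiable except at finitely many dyadic rationals, and have derivatives that are powers of $2$ elsewhere. For $T$, the set $[0,1/2]$ denotes its image in the circle. Thompson's group $V$ is the analogous group of right-continuous bijections of $[0,1)$ that map dyadic rationals to dyadic rationals, are differentiable except at finitely many dyadic rationals, and on each maximal interval of differentiability are affine with slope a power of $2$. All three groups are finitely generated. For a locally finite graph $\Gamma$ (a locally finite $1$-dimensional CW complex) and a compact $C\subseteq\Gamma$, let $\mathrm{Comp}_\infty(\Gamma-C)$ be the set of unbounded components of $\Gamma-C$, i.e. those connected components whose closure is not compact. The number of ends of $\Gamma$ is $e(\Gamma)=\sup_C |\mathrm{Comp}_\infty(\Gamma-C)|$,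 the supremum being over compact $C\subseteq\Gamma$. For a group $G$ with finite generating set $S$, the Cayley graph $\Gamma_S(G)$ has vertex set $G$ and an edge $e(g,s)$ connecting $g$ to $gs$ for each $g\in G$, $s\in S$. For $H\le G$, the coset graph $\Gamma_S(H\backslash G)$ is the quotient of $\Gamma_S(G)$ by the natural left action of $H$. The number of ends of the pair $(G,H)$ is $e(G,H)=e(\Gamma_S(H\backslash G))$, which does not depend on the choice of finite generating set $S$. *)

theory Defs
  imports
    "HOL-Analysis.Analysis"
    "HOL-Algebra.Bij"
    "HOL-Algebra.Generated_Groups"
    "HOL-Algebra.Group_Action"
    "HOL-Library.Extended_Nat"
    "Graph_Theory.Digraph"
begin

section \<open>Quotient topologies\<close>

definition quotient_topology :: "'a topology \<Rightarrow> ('a \<Rightarrow> 'b) \<Rightarrow> 'b topology" where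
  "quotient_topology X f =
     topology (\<lambda>U. U \<subseteq> f ` topspace X \<and> openin X {x \<in> topspace X. f x \<in> U})"

lemma openin_quotient_topology:
  "openin (quotient_topology X f) U \<longleftrightarrow>
     U \<subseteq> f ` topspace X \<and> openin X {x \<in> topspace X. f x \<in> U}"
proof -
  have "istopology (\<lambda>U. U \<subseteq> f ` topspace X \<and> openin X {x \<in> topspace X. f x \<in> U})"
    unfolding istopology_def
  proof (intro conjI allI impI)
    fix S T
    assume "S \<subseteq> f ` topspace X \<and> openin X {x \<in> topspace X. f x \<in> S}"
      and "T \<subseteq> f ` topspace X \<and> openin X {x \<in> topspace X. f x \<in> T}"
    moreover have "{x \<in> topspace X. f x \<in> S \<inter> T} =
        {x \<in> topspace X. f x \<in> S} \<inter> {x \<in> topspace X. f x \<in> T}" by auto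
    ultimately show "S \<inter> T \<subseteq> f ` topspace X" "openin X {x \<in> topspace X. f x \<in> S \<inter> T}"
      by auto
  next
    fix \<K>
    assume *: "\<forall>K\<in>\<K>. K \<subseteq> f ` topspace X \<and> openin X {x \<in> topspace X. f x \<in> K}"
    then show "\<Union>\<K> \<subseteq> f ` topspace X" by blast
    have "{x \<in> topspace X. f x \<in> \<Union>\<K>} = (\<Union>K\<in>\<K>. {x \<in> topspace X. f x \<in> K})" by auto
    then show "openin X {x \<in> topspace X. f x \<in> \<Union>\<K>}" using * by auto
  qed
  then show ?thesis by (simp add: quotient_topology_def)
qed

lemma topspace_quotient_topology: "topspace (quotient_topology X f) = f ` topspace X"
proof (rule antisym)
  show "topspace (quotient_topology X f) \<subseteq> f ` topspace X"
    by (metis openin_quotient_topology openin_topspace)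
  have "{x \<in> topspace X. f x \<in> f ` topspace X} = topspace X" by auto
  then have "openin (quotient_topology X f) (f ` topspace X)"
    by (simp add: openin_quotient_topology)
  then show "f ` topspace X \<subseteq> topspace (quotient_topology X f)"
    by (rule openin_subset)
qed

lemma quotient_map_quotient_topology: "quotient_map X (quotient_topology X f) f"
  by (simp add: quotient_map_def topspace_quotient_topology openin_quotient_topology)


section \<open>Ends of graphs and of pairs of groups\<close>

text \<open>
  A graph is given by a \<^type>\<open>pre_digraph\<close>: loops and multiple edges are allowed, and the
  orientation of an arc serves only to parametrise the corresponding 1-cell by \<open>[0,1]\<close>.
  The points of the CW complex are the vertices \<open>Inl v\<close> and the points \<open>Inr (e, t)\<close>,
  \<open>0 < t < 1\<close>, of the open 1-cells.
\<close>

definition cell_map :: "('v, 'e) pre_digraph \<Rightarrow> 'e \<Rightarrow> real \<Rightarrow> 'v + 'e \<times> real" where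
  "cell_map \<Gamma> e t =
     (if t = 0 then Inl (tail \<Gamma> e) else if t = 1 then Inl (head \<Gamma> e) else Inr (e, t))"

definition graph_points :: "('v, 'e) pre_digraph \<Rightarrow> ('v + 'e \<times> real) set" where
  "graph_points \<Gamma> = Inl ` verts \<Gamma> \<union> Inr ` (arcs \<Gamma> \<times> {0<..<1})"

text \<open>The weak topology with respect to the characteristic maps of the closed 1-cells.\<close>

definition realization :: "('v, 'e) pre_digraph \<Rightarrow> ('v + 'e \<times> real) topology" where
  "realization \<Gamma> = topology (\<lambda>U. U \<subseteq> graph_points \<Gamma> \<and>
     (\<forall>e \<in> arcs \<Gamma>. openin (top_of_set {0..1}) {t \<in> {0..1}. cell_map \<Gamma> e t \<in> U}))"

lemma openin_realization:
  "openin (realization \<Gamma>) U \<longleftrightarrow> U \<subseteq> graph_points \<Gamma> \<and>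
     (\<forall>e \<in> arcs \<Gamma>. openin (top_of_set {0..1}) {t \<in> {0..1}. cell_map \<Gamma> e t \<in> U})"
proof -
  have "istopology (\<lambda>U. U \<subseteq> graph_points \<Gamma> \<and>
     (\<forall>e \<in> arcs \<Gamma>. openin (top_of_set {0..1}) {t \<in> {0..1}. cell_map \<Gamma> e t \<in> U}))"
    unfolding istopology_def
  proof (intro conjI allI impI ballI)
    fix S T e
    assume *: "S \<subseteq> graph_points \<Gamma> \<and>
        (\<forall>e \<in> arcs \<Gamma>. openin (top_of_set {0..1}) {t \<in> {0..1}. cell_map \<Gamma> e t \<in> S})"
      "T \<subseteq> graph_points \<Gamma> \<and>
        (\<forall>e \<in> arcs \<Gamma>. openin (top_of_set {0..1}) {t \<in> {0..1}. cell_map \<Gamma> e t \<in> T})"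
    then show "S \<inter> T \<subseteq> graph_points \<Gamma>" by blast
    assume e: "e \<in> arcs \<Gamma>"
    have "{t \<in> {0..1}. cell_map \<Gamma> e t \<in> S \<inter> T} =
        {t \<in> {0..1}. cell_map \<Gamma> e t \<in> S} \<inter> {t \<in> {0..1}. cell_map \<Gamma> e t \<in> T}" by auto
    then show "openin (top_of_set {0..1}) {t \<in> {0..1}. cell_map \<Gamma> e t \<in> S \<inter> T}"
      using * e by (simp only: openin_Int)
  next
    fix \<K>
    assume *: "\<forall>K\<in>\<K>. K \<subseteq> graph_points \<Gamma> \<and>
        (\<forall>e \<in> arcs \<Gamma>. openin (top_of_set {0..1}) {t \<in> {0..1}. cell_map \<Gamma> e t \<in> K})"
    then show "\<Union>\<K> \<subseteq> graph_points \<Gamma>" by blast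
    fix e assume e: "e \<in> arcs \<Gamma>"
    have "{t \<in> {0..1}. cell_map \<Gamma> e t \<in> \<Union>\<K>} =
        (\<Union>K\<in>\<K>. {t \<in> {0..1}. cell_map \<Gamma> e t \<in> K})" by auto
    then show "openin (top_of_set {0..1}) {t \<in> {0..1}. cell_map \<Gamma> e t \<in> \<Union>\<K>}"
      using * e by (simp only:) (intro openin_Union ballI; elim imageE; simp)
  qed
  then show ?thesis by (simp add: realization_def)
qed

lemma topspace_realization:
  assumes "wf_digraph \<Gamma>"
  shows "topspace (realization \<Gamma>) = graph_points \<Gamma>"
proof (rule antisym)
  show "topspace (realization \<Gamma>) \<subseteq> graph_points \<Gamma>"
    by (metis openin_realization openin_topspace)
  have "{t \<in> {0..1}. cell_map \<Gamma> e t \<in> graph_points \<Gamma>} = {0..1}" if "e \<in> arcs \<Gamma>" for e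
    using that assms by (auto simp: cell_map_def graph_points_def wf_digraph_def)
  then have "openin (realization \<Gamma>) (graph_points \<Gamma>)"
    by (simp add: openin_realization)
  then show "graph_points \<Gamma> \<subseteq> topspace (realization \<Gamma>)"
    by (rule openin_subset)
qed

definition unbounded_components :: "'a topology \<Rightarrow> 'a set \<Rightarrow> 'a set set" where
  "unbounded_components X C =
     {K \<in> connected_components_of (subtopology X (topspace X - C)).
        \<not> compactin X (X closure_of K)}"

text \<open>\<^const>\<open>card\<close> is \<open>0\<close> on infinite sets, hence:\<close>

definition ecard :: "'a set \<Rightarrow> enat" where
  "ecard A = (if finite A then enat (card A) else \<infinity>)"

definition ends :: "('v, 'e) pre_digraph \<Rightarrow> enat" where
  "ends \<Gamma> = (SUP C \<in> {C. compactin (realization \<Gamma>) C}.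
                ecard (unbounded_components (realization \<Gamma>) C))"

text \<open>The arc \<open>(g, s)\<close> is the edge \<open>e(g,s)\<close> connecting \<open>g\<close> to \<open>gs\<close>.\<close>

definition cayley_graph :: "('a, 'b) monoid_scheme \<Rightarrow> 'a set \<Rightarrow> ('a, 'a \<times> 'a) pre_digraph" where
  "cayley_graph G S =
     \<lparr>verts = carrier G, arcs = carrier G \<times> S, tail = fst, head = (\<lambda>(g, s). g \<otimes>\<^bsub>G\<^esub> s)\<rparr>"

text \<open>
  The quotient of the Cayley graph by the left action of \<open>H\<close>, whose vertices and edges are the
  orbits of vertices and edges. As tail and head are equivariant, the image of an edge orbit
  under either of them is a vertex orbit.
\<close>

definition coset_graph ::
    "('a, 'b) monoid_scheme \<Rightarrow> 'a set \<Rightarrow> 'a set \<Rightarrow> ('a set, ('a \<times> 'a) set) pre_digraph" where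
  "coset_graph G S H =
     (let \<Gamma> = cayley_graph G S; G\<^sub>H = G\<lparr>carrier := H\<rparr> in
      \<lparr>verts = orbits G\<^sub>H (verts \<Gamma>) (\<lambda>h g. h \<otimes>\<^bsub>G\<^esub> g),
       arcs = orbits G\<^sub>H (arcs \<Gamma>) (\<lambda>h (g, s). (h \<otimes>\<^bsub>G\<^esub> g, s)),
       tail = image (tail \<Gamma>),
       head = image (head \<Gamma>)\<rparr>)"

definition finite_generating_set :: "('a, 'b) monoid_scheme \<Rightarrow> 'a set \<Rightarrow> bool" where
  "finite_generating_set G S \<longleftrightarrow> finite S \<and> S \<subseteq> carrier G \<and> generate G S = carrier G"

text \<open>
  The number of ends \<open>e(G,H)\<close> computed with the finite generating set \<open>S\<close>; its value does not
  depend on \<open>S\<close>.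
\<close>

definition pair_ends :: "('a, 'b) monoid_scheme \<Rightarrow> 'a set \<Rightarrow> 'a set \<Rightarrow> enat" where
  "pair_ends G H S = ends (coset_graph G S H)"


section \<open>Thompson's groups\<close>

text \<open>
  Elements of the groups are extensional functions (arbitrary but fixed outside the set they
  permute), as in \<^const>\<open>BijGroup\<close>; the product of \<open>g\<close> and \<open>h\<close> is \<open>g \<circ> h\<close>.
  The set \<^const>\<open>dyadics\<close> consists of the nonnegative dyadic rationals only; it is used only
  within \<open>[0,1]\<close>.
\<close>

definition nondiff_points :: "real set \<Rightarrow> (real \<Rightarrow> real) \<Rightarrow> real set" where
  "nondiff_points A h = {x \<in> A. \<not> h differentiable (at x within A)}"

definition piecewise_linear_on :: "real set \<Rightarrow> (real \<Rightarrow> real) \<Rightarrow> bool" where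
  "piecewise_linear_on A h \<longleftrightarrow>
     (\<exists>P. finite P \<and> (\<forall>J \<in> components (A - P). \<exists>a b. \<forall>x \<in> J. h x = a * x + b))"

definition thompson_F :: "(real \<Rightarrow> real) monoid" where
  "thompson_F = (BijGroup {0..1})\<lparr>carrier :=
     {h \<in> extensional {0..1}.
        homeomorphic_map (top_of_set {0..1}) (top_of_set {0..1}) h \<and>
        piecewise_linear_on {0..1} h \<and>
        finite (nondiff_points {0..1} h) \<and>
        nondiff_points {0..1} h \<subseteq> dyadics \<and>
        (\<forall>x \<in> {0..1} - nondiff_points {0..1} h.
           \<exists>i::int. (h has_real_derivative 2 powi i) (at x within {0..1}))}\<rparr>"

text \<open>
  The circle \<open>[0,1]/(0 \<sim> 1)\<close>: the points are represented by \<open>[0,1)\<close>, and on \<open>[0,1]\<close> the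
  quotient map is \<^const>\<open>frac\<close>.
\<close>

definition circle :: "real topology" where
  "circle = quotient_topology (top_of_set {0..1}) frac"

lemma topspace_circle: "topspace circle = {0..<1}"
proof -
  have "frac ` {0..1::real} = {0..<1}"
  proof (intro equalityI subsetI)
    fix x :: real assume "x \<in> {0..<1}"
    then show "x \<in> frac ` {0..1}" by (intro image_eqI[of _ _ x]) (auto simp: frac_eq)
  qed (auto simp: frac_lt_1)
  then show ?thesis by (simp add: circle_def topspace_quotient_topology)
qed

text \<open>
  An orientation-preserving homeomorphism of the circle has an increasing lift to the universal
  cover \<open>frac: \<real> \<rightarrow> [0,1)\<close>, through which piecewise linearity and differentiability (at \<open>0\<close>
  too, where the representing function on \<open>[0,1)\<close> may jump) are expressed.
\<close>

definition circle_lift :: "(real \<Rightarrow> real) \<Rightarrow> (real \<Rightarrow> real) \<Rightarrow> bool" where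
  "circle_lift h H \<longleftrightarrow> continuous_on UNIV H \<and> (\<forall>x. frac (H x) = h (frac x))"

definition thompson_T :: "(real \<Rightarrow> real) monoid" where
  "thompson_T = (BijGroup {0..<1})\<lparr>carrier :=
     {h \<in> extensional {0..<1}.
        homeomorphic_map circle circle h \<and>
        h ` (dyadics \<inter> {0..<1}) \<subseteq> dyadics \<and>
        (\<exists>H. circle_lift h H \<and> strict_mono H \<and> (\<forall>x. H (x + 1) = H x + 1) \<and>
             piecewise_linear_on {0..1} H \<and>
             finite (nondiff_points UNIV H \<inter> {0..<1}) \<and>
             nondiff_points UNIV H \<inter> {0..<1} \<subseteq> dyadics \<and>
             (\<forall>x. x \<notin> nondiff_points UNIV H \<longrightarrow>
                (\<exists>i::int. (H has_real_derivative 2 powi i) (at x))))}\<rparr>"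

text \<open>
  The maximal intervals of differentiability are the components of the set of points of
  differentiability.
\<close>

definition thompson_V :: "(real \<Rightarrow> real) monoid" where
  "thompson_V = (BijGroup {0..<1})\<lparr>carrier :=
     {h \<in> Bij {0..<1}.
        (\<forall>x \<in> {0..<1}. continuous (at_right x) h) \<and>
        h ` (dyadics \<inter> {0..<1}) \<subseteq> dyadics \<and>
        finite (nondiff_points {0..<1} h) \<and>
        nondiff_points {0..<1} h \<subseteq> dyadics \<and>
        (\<forall>J \<in> components ({0..<1} - nondiff_points {0..<1} h).
           \<exists>(i::int) b. \<forall>x \<in> J. h x = 2 powi i * x + b)}\<rparr>"

definition fixing_subgroup :: "('x \<Rightarrow> 'x, 'b) monoid_scheme \<Rightarrow> 'x set \<Rightarrow> ('x \<Rightarrow> 'x) set" where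
  "fixing_subgroup G A = {g \<in> carrier G. \<forall>x \<in> A. g x = x}"

end

theory Submission
  imports Defs
begin

text \<open>
  The coset \<open>H g\<close> of the fixing subgroup \<open>H\<close> is the same thing as the embedding \<open>g\<^sup>-\<^sup>1\<close> of
  \<open>[0,1/2)\<close> into \<open>[0,1)\<close>, on which \<open>s \<in> G\<close> acts by postcomposition with \<open>s\<^sup>-\<^sup>1\<close>. Every element of
  \<open>F\<close>, \<open>T\<close> or \<open>V\<close> maps all but finitely many standard dyadic intervals affinely onto standard
  dyadic intervals. Hence the set \<open>A\<^sub>0\<close> of the embeddings that are affine onto a standard dyadic
  interval has finite coboundary in the coset graph, and so do its translates \<open>A\<^sub>i\<close>, consisting of
  the embeddings whose composite with \<open>q\<^sup>i\<close> lies in \<open>A\<^sub>0\<close>, where \<open>q\<close> is supported on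
  \<open>[0,1/2]\<close> and has infinite order. The \<open>A\<^sub>i\<close> are infinite and pairwise disjoint. Removing the
  finitely many vertices on the coboundaries of \<open>n\<close> of them leaves an unbounded component in each.
\<close>

section \<open>Graphs with infinitely many ends\<close>

text \<open>The translates keep the finite coboundary because \<open>q\<close> maps [0,1/2) onto
  itself: it normalizes the fixing subgroup, so left multiplication by \<open>q\<close> is an
  automorphism of the coset graph. They are disjoint because near 0 the map \<open>q^i\<close> is
  division by 2^i, whereas precomposing an embedding with \<open>q^i\<close> does not change its
  image: the length of the image and the slope at 0 together recover i. Infinitely many members of
  one translate come from the powers of a map \<open>p\<close> that halves [0,1/2). The three groups
  are defined in different terms: derivatives of a homeomorphism, derivatives of a lift, affine
  formulas on maximal intervals. All are translated into \<open>dyadic_table\<close>, whose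
  half-open pieces partition [0,1), so that the jumps of V and of the representatives of T cause no
  conflict at endpoints. Closure under composition is read off from the generating set rather than
  checked piece by piece.\<close>

lemma openin_interval_minus_endpoints:
  assumes "{0<..<1} \<subseteq> T" "T \<subseteq> {0..1::real}"
  shows "openin (top_of_set {0..1}) T"
proof -
  have "T = {0..1} \<inter> - ({0,1} - T)"
    using assms by (auto simp: subset_iff) (metis less_eq_real_def)
  moreover have "open (- ({0,1} - T))"
    by (intro open_Compl finite_imp_closed) auto
  ultimately show ?thesis
    by (metis openin_open)
qed

lemma continuous_map_cell_map:
  assumes "wf_digraph \<Gamma>" "e \<in> arcs \<Gamma>"
  shows "continuous_map (top_of_set {0..1}) (realization \<Gamma>) (cell_map \<Gamma> e)"
  unfolding continuous_map_def
proof (intro conjI allI impI)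
  show "cell_map \<Gamma> e \<in> topspace (top_of_set {0..1}) \<rightarrow> topspace (realization \<Gamma>)"
    using assms by (auto simp: topspace_realization cell_map_def graph_points_def wf_digraph_def)
qed (use assms in \<open>auto simp: openin_realization\<close>)

text \<open>Openness in the weak topology is tested on one closed cell at a time, and a cell loses
  at most its two endpoints, so \<open>W\<close> may be infinite.\<close>

lemma openin_realization_minus_verts:
  assumes "wf_digraph \<Gamma>"
  shows "openin (realization \<Gamma>) (graph_points \<Gamma> - Inl ` W)"
  unfolding openin_realization
proof (intro conjI ballI openin_interval_minus_endpoints)
  fix e assume "e \<in> arcs \<Gamma>"
  then show "{0<..<1} \<subseteq> {t \<in> {0..1}. cell_map \<Gamma> e t \<in> graph_points \<Gamma> - Inl ` W}"
    by (auto simp: cell_map_def graph_points_def)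
qed auto

text \<open>The open cells together with at most one vertex form an open set; finitely many such
  sets contain finitely many vertices. This is the test for unboundedness used below: a component
  with infinitely many vertices has no compact closure.\<close>

lemma compactin_realization_finite_verts:
  assumes "wf_digraph \<Gamma>" and C: "compactin (realization \<Gamma>) C"
  shows "finite {v. Inl v \<in> C}"
proof -
  let ?O = "\<lambda>v. graph_points \<Gamma> - Inl ` (verts \<Gamma> - {v})"
  have CX: "C \<subseteq> graph_points \<Gamma>"
    using compactin_subset_topspace[OF C] by (simp add: topspace_realization assms)
  let ?U = "insert (graph_points \<Gamma> - Inl ` verts \<Gamma>) (?O ` verts \<Gamma>)"
  have "C \<subseteq> \<Union>?U" using CX by (auto simp: graph_points_def)
  moreover have "\<forall>U\<in>?U. openin (realization \<Gamma>) U"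
    using openin_realization_minus_verts[OF assms(1)] by blast
  ultimately have "\<exists>F. finite F \<and> F \<subseteq> ?U \<and> C \<subseteq> \<Union>F"
    by (intro compactinD[OF C]) blast+
  then obtain F where F: "finite F" "F \<subseteq> ?U" "C \<subseteq> \<Union>F"
    by blast
  have "finite {v. Inl v \<in> U}" if U: "U \<in> F" for U
  proof -
    obtain v where "U \<subseteq> graph_points \<Gamma> - Inl ` (verts \<Gamma> - {v})"
      using F(2) U by blast
    then have "{v. Inl v \<in> U} \<subseteq> {v}" by (auto simp: graph_points_def)
    then show ?thesis by (rule finite_subset) simp
  qed
  then have "finite (\<Union>U\<in>F. {v. Inl v \<in> U})" using F(1) by blast
  moreover have "{v. Inl v \<in> C} \<subseteq> (\<Union>U\<in>F. {v. Inl v \<in> U})" using F(3) by blast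
  ultimately show ?thesis using finite_subset by blast
qed

section \<open>Components of the complement of a vertex set\<close>

context
  fixes \<Gamma> :: "('v, 'e) pre_digraph" and K :: "'v set"
  assumes wf: "wf_digraph \<Gamma>"
begin

abbreviation "remainder \<equiv> subtopology (realization \<Gamma>) (topspace (realization \<Gamma>) - Inl ` K)"

lemma connected_component_of_arc:
  assumes "e \<in> arcs \<Gamma>" "tail \<Gamma> e \<notin> K" "head \<Gamma> e \<notin> K"
  shows "connected_component_of remainder (Inl (tail \<Gamma> e)) (Inl (head \<Gamma> e))"
proof -
  have "cell_map \<Gamma> e \<in> {0..1} \<rightarrow> topspace (realization \<Gamma>) - Inl ` K"
    using assms wf
    by (auto simp: topspace_realization cell_map_def graph_points_def wf_digraph_def split: if_splits)
  then have "continuous_map (top_of_set {0..1}) remainder (cell_map \<Gamma> e)"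
    using continuous_map_cell_map[OF wf assms(1)]
    by (auto simp: continuous_map_in_subtopology)
  moreover have "connectedin (top_of_set {0..1}) {0..1::real}"
    by (simp add: connectedin_subtopology)
  ultimately have "connectedin remainder (cell_map \<Gamma> e ` {0..1})"
    by (rule connectedin_continuous_map_image)
  moreover have "Inl (tail \<Gamma> e) = cell_map \<Gamma> e 0" "Inl (head \<Gamma> e) = cell_map \<Gamma> e 1"
    by (auto simp: cell_map_def)
  ultimately show ?thesis
    unfolding connected_component_of_def
    by (metis atLeastAtMost_iff imageI order_refl zero_le_one)
qed

text \<open>The last vertex before a path from \<open>v\<close> to \<open>K\<close> first enters \<open>K\<close>.\<close>

lemma connected_component_of_near_removed:
  assumes "(v, k) \<in> (arcs_ends \<Gamma> \<union> (arcs_ends \<Gamma>)\<inverse>)\<^sup>*" "k \<in> K" "v \<in> verts \<Gamma> - K"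
  shows "\<exists>w k'. w \<notin> K \<and> k' \<in> K \<and> (w, k') \<in> arcs_ends \<Gamma> \<union> (arcs_ends \<Gamma>)\<inverse> \<and>
    connected_component_of remainder (Inl v) (Inl w)"
  using assms
proof (induction rule: converse_rtrancl_induct)
  case (step v z)
  show ?case
  proof (cases "z \<in> K")
    case True
    have "Inl v \<in> topspace remainder"
      using step.prems wf by (auto simp: topspace_realization graph_points_def)
    then show ?thesis
      using True step by (metis Diff_iff connected_component_of_refl)
  next
    case False
    have z: "z \<in> verts \<Gamma>"
      using step.hyps(1) wf by (auto simp: arcs_ends_conv wf_digraph_def)
    have "connected_component_of remainder (Inl v) (Inl z)"
    proof -
      obtain e where "e \<in> arcs \<Gamma>"
          "v = tail \<Gamma> e \<and> z = head \<Gamma> e \<or> z = tail \<Gamma> e \<and> v = head \<Gamma> e"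
        using step.hyps(1) by (auto simp: arcs_ends_conv)
      then show ?thesis
      proof (elim disjE conjE)
        assume e: "e \<in> arcs \<Gamma>" "z = tail \<Gamma> e" "v = head \<Gamma> e"
        then have "connected_component_of remainder (Inl z) (Inl v)"
          using connected_component_of_arc[of e] False step.prems by simp
        then show ?thesis by (rule iffD1[OF connected_component_of_sym])
      next
        assume e: "e \<in> arcs \<Gamma>" "v = tail \<Gamma> e" "z = head \<Gamma> e"
        then show ?thesis
          using connected_component_of_arc[of e] False step.prems by simp
      qed
    qed
    moreover obtain w k' where "w \<notin> K" "k' \<in> K" "(w, k') \<in> arcs_ends \<Gamma> \<union> (arcs_ends \<Gamma>)\<inverse>"
        "connected_component_of remainder (Inl z) (Inl w)"
      using step.IH[OF step.prems(1)] z False by blast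
    ultimately show ?thesis by (blast intro: connected_component_of_trans)
  qed
qed auto

text \<open>As the coboundary of \<open>A\<close> is contained in \<open>K\<close>, the part of the graph spanned by \<open>A\<close> is
  open and closed in the complement of \<open>K\<close>.\<close>

lemma connected_component_of_in_side:
  assumes cob: "\<And>e. e \<in> arcs \<Gamma> \<Longrightarrow> (tail \<Gamma> e \<in> A) \<noteq> (head \<Gamma> e \<in> A) \<Longrightarrow>
      tail \<Gamma> e \<in> K \<and> head \<Gamma> e \<in> K"
    and v: "v \<in> A" "connected_component_of remainder (Inl v) (Inl w)"
  shows "w \<in> A"
proof (rule ccontr)
  assume w: "w \<notin> A"
  \<comment> \<open>The full subgraph on \<open>A\<close>. An edge crossing the boundary of
    \<open>A\<close> has both ends in \<open>K\<close>; what is left of it after removing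
    \<open>K\<close> is an open cell lying entirely in \<open>?W\<close>.\<close>
  define In where "In = Inl ` A \<union> Inr ` ({e. tail \<Gamma> e \<in> A \<and> head \<Gamma> e \<in> A} \<times> (UNIV::real set))"
  let ?U = "(graph_points \<Gamma> - Inl ` K) \<inter> In"
  let ?W = "(graph_points \<Gamma> - Inl ` K) - In"
  have "openin (realization \<Gamma>) ?U"
    unfolding openin_realization
  proof (intro conjI ballI)
    fix e assume e: "e \<in> arcs \<Gamma>"
    show "openin (top_of_set {0..1}) {t \<in> {0..1}. cell_map \<Gamma> e t \<in> ?U}"
    proof (cases "tail \<Gamma> e \<in> A \<and> head \<Gamma> e \<in> A")
      case True
      then show ?thesis
        using e by (intro openin_interval_minus_endpoints)
          (auto simp: cell_map_def graph_points_def In_def)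
    next
      case False
      then have "{t \<in> {0..1}. cell_map \<Gamma> e t \<in> ?U} = {}"
        using cob[OF e] by (auto simp: cell_map_def In_def split: if_splits)
      then show ?thesis by (simp only: openin_empty)
    qed
  qed auto
  moreover have "openin (realization \<Gamma>) ?W"
    unfolding openin_realization
  proof (intro conjI ballI)
    fix e assume e: "e \<in> arcs \<Gamma>"
    show "openin (top_of_set {0..1}) {t \<in> {0..1}. cell_map \<Gamma> e t \<in> ?W}"
    proof (cases "tail \<Gamma> e \<in> A \<and> head \<Gamma> e \<in> A")
      case False
      then show ?thesis
        using e by (intro openin_interval_minus_endpoints)
          (auto simp: cell_map_def graph_points_def In_def)
    next
      case True
      then have "{t \<in> {0..1}. cell_map \<Gamma> e t \<in> ?W} = {}"
        by (auto simp: cell_map_def In_def)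
      then show ?thesis by (simp only: openin_empty)
    qed
  qed auto
  moreover obtain T where T: "connectedin remainder T" "Inl v \<in> T" "Inl w \<in> T"
    using v by (auto simp: connected_component_of_def)
  ultimately show False
  proof -
    assume U: "openin (realization \<Gamma>) ?U" and W: "openin (realization \<Gamma>) ?W"
    have T': "connectedin (realization \<Gamma>) T" "T \<subseteq> graph_points \<Gamma> - Inl ` K"
      using T(1) by (auto simp: connectedin_subtopology topspace_realization[OF wf])
    moreover have "T \<subseteq> ?U \<union> ?W" "?U \<inter> ?W \<inter> T = {}" using T'(2) by blast+
    moreover have "Inl v \<in> ?U" "Inl w \<in> ?W"
      using T T'(2) v w by (auto simp: In_def)
    ultimately show False
      using T(2,3) U W unfolding connectedin by blast
  qed
qed

text \<open>Every vertex outside \<open>K\<close> shares its component with a neighbour of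
  \<open>K\<close>: follow a path to \<open>k\<close> and stop before it enters \<open>K\<close>.
  Local finiteness leaves finitely many neighbours, so by pigeonhole one component contains
  infinitely many vertices of \<open>A\<close>, and it cannot leave \<open>A\<close>.\<close>

lemma exists_unbounded_component:
  assumes fin: "finite K" and K: "k \<in> K" "k \<in> verts \<Gamma>"
    and loc: "\<And>v. v \<in> verts \<Gamma> \<Longrightarrow> finite {e \<in> arcs \<Gamma>. tail \<Gamma> e = v \<or> head \<Gamma> e = v}"
    and conn: "\<And>u v. u \<in> verts \<Gamma> \<Longrightarrow> v \<in> verts \<Gamma> \<Longrightarrow>
      (u, v) \<in> (arcs_ends \<Gamma> \<union> (arcs_ends \<Gamma>)\<inverse>)\<^sup>*"
    and cob: "\<And>e. e \<in> arcs \<Gamma> \<Longrightarrow> (tail \<Gamma> e \<in> A) \<noteq> (head \<Gamma> e \<in> A) \<Longrightarrow>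
      tail \<Gamma> e \<in> K \<and> head \<Gamma> e \<in> K"
    and A: "A \<subseteq> verts \<Gamma>" "infinite A"
  shows "\<exists>D \<in> unbounded_components (realization \<Gamma>) (Inl ` K). \<exists>w\<in>A. Inl w \<in> D \<and> {v. Inl v \<in> D} \<subseteq> A"
proof -
  define N where "N = {w. \<exists>k\<in>K. (w, k) \<in> arcs_ends \<Gamma> \<union> (arcs_ends \<Gamma>)\<inverse>}"
  have "N \<subseteq> (\<Union>k\<in>K \<inter> verts \<Gamma>. tail \<Gamma> ` {e \<in> arcs \<Gamma>. tail \<Gamma> e = k \<or> head \<Gamma> e = k} \<union>
       head \<Gamma> ` {e \<in> arcs \<Gamma>. tail \<Gamma> e = k \<or> head \<Gamma> e = k})" (is "_ \<subseteq> ?N")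
    using wf by (fastforce simp: N_def arcs_ends_conv wf_digraph_def)
  moreover have "finite ?N" using fin loc by blast
  ultimately have "finite N" using finite_subset by blast
  have "A - K \<subseteq> (\<Union>w\<in>N. {v \<in> A - K. connected_component_of remainder (Inl v) (Inl w)})"
  proof
    fix v assume v: "v \<in> A - K"
    then have "v \<in> verts \<Gamma> - K" using A by blast
    then show "v \<in> (\<Union>w\<in>N. {v \<in> A - K. connected_component_of remainder (Inl v) (Inl w)})"
      using connected_component_of_near_removed[OF conn K(1), of v] v K by (auto simp: N_def)
  qed
  moreover have "infinite (A - K)" using A(2) fin by (rule Diff_infinite_finite[rotated])
  ultimately have "infinite (\<Union>w\<in>N. {v \<in> A - K. connected_component_of remainder (Inl v) (Inl w)})"
    using finite_subset by blast
  then obtain w where w: "infinite {v \<in> A - K. connected_component_of remainder (Inl v) (Inl w)}"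
    using \<open>finite N\<close> by blast
  define D where "D = connected_component_of_set remainder (Inl w)"
  have inD: "{v \<in> A - K. connected_component_of remainder (Inl v) (Inl w)} \<subseteq> {v. Inl v \<in> D}"
    by (auto simp: D_def connected_component_of_sym)
  obtain v0 where v0: "v0 \<in> A" "connected_component_of remainder (Inl v0) (Inl w)"
    using infinite_imp_nonempty[OF w] by auto
  have wA: "w \<in> A" using connected_component_of_in_side[OF cob v0] .
  have wtop: "Inl w \<in> topspace remainder"
    using connected_component_in_topspace[OF v0(2)] by blast
  have "D \<subseteq> topspace (realization \<Gamma>)"
    using connected_component_of_subset_topspace by (fastforce simp: D_def)
  then have "D \<subseteq> realization \<Gamma> closure_of D" by (simp add: closure_of_subset)
  then have "{v. Inl v \<in> D} \<subseteq> {v. Inl v \<in> realization \<Gamma> closure_of D}" by blast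
  with inD have "infinite {v. Inl v \<in> realization \<Gamma> closure_of D}"
    by (rule infinite_super[OF order_trans w])
  then have "\<not> compactin (realization \<Gamma>) (realization \<Gamma> closure_of D)"
    by (rule contrapos_nn) (rule compactin_realization_finite_verts[OF wf])
  moreover have "D \<in> connected_components_of remainder"
    unfolding D_def using wtop by (rule iffD2[OF connected_component_in_connected_components_of])
  moreover have "Inl w \<in> D"
    unfolding D_def using wtop by (intro CollectI iffD2[OF connected_component_of_refl])
  moreover have "{v. Inl v \<in> D} \<subseteq> A"
    using connected_component_of_in_side[OF cob wA] by (auto simp: D_def)
  ultimately show ?thesis using wA by (auto simp: unbounded_components_def)
qed

end

text \<open>One compact set, the ends of the boundary edges, cuts off the first n sides at once.
  Their unbounded components are told apart by the disjoint sides that contain their vertices, so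
  the supremum is at least every n.\<close>

theorem ends_eq_infinity:
  fixes A :: "nat \<Rightarrow> 'v set"
  assumes wf: "wf_digraph \<Gamma>"
    and loc: "\<And>v. v \<in> verts \<Gamma> \<Longrightarrow> finite {e \<in> arcs \<Gamma>. tail \<Gamma> e = v \<or> head \<Gamma> e = v}"
    and conn: "\<And>u v. u \<in> verts \<Gamma> \<Longrightarrow> v \<in> verts \<Gamma> \<Longrightarrow>
      (u, v) \<in> (arcs_ends \<Gamma> \<union> (arcs_ends \<Gamma>)\<inverse>)\<^sup>*"
    and A: "\<And>i. A i \<subseteq> verts \<Gamma>" "\<And>i. infinite (A i)"
    and disj: "disjoint_family A"
    and cob: "\<And>i. finite {e \<in> arcs \<Gamma>. (tail \<Gamma> e \<in> A i) \<noteq> (head \<Gamma> e \<in> A i)}"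
  shows "ends \<Gamma> = \<infinity>"
proof -
  have "enat n \<le> ends \<Gamma>" for n
  proof -
    obtain k where k: "k \<in> A 0" using A(2)[of 0] by (metis finite.emptyI ex_in_conv)
    define E where "E = (\<Union>i<n. {e \<in> arcs \<Gamma>. (tail \<Gamma> e \<in> A i) \<noteq> (head \<Gamma> e \<in> A i)})"
    \<comment> \<open>\<open>k\<close> keeps \<open>K\<close> nonempty even if there are no boundary
      edges, so that paths have a target in \<open>K\<close>.\<close>
    define K where "K = insert k (tail \<Gamma> ` E \<union> head \<Gamma> ` E)"
    have fin: "finite K" using cob by (simp add: K_def E_def)
    have sub: "K \<subseteq> verts \<Gamma>" using k A(1)[of 0] wf by (auto simp: K_def E_def wf_digraph_def)
    have "\<exists>D \<in> unbounded_components (realization \<Gamma>) (Inl ` K).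
        \<exists>w\<in>A i. Inl w \<in> D \<and> {v. Inl v \<in> D} \<subseteq> A i" if "i < n" for i
    proof (rule exists_unbounded_component[OF wf fin])
      fix e assume "e \<in> arcs \<Gamma>" "(tail \<Gamma> e \<in> A i) \<noteq> (head \<Gamma> e \<in> A i)"
      then have "e \<in> E" using that by (auto simp: E_def)
      then show "tail \<Gamma> e \<in> K \<and> head \<Gamma> e \<in> K" by (auto simp: K_def)
    qed (use k A sub loc conn in \<open>auto simp: K_def\<close>)
    then obtain D where D: "\<And>i. i < n \<Longrightarrow> D i \<in> unbounded_components (realization \<Gamma>) (Inl ` K) \<and>
        (\<exists>w\<in>A i. Inl w \<in> D i \<and> {v. Inl v \<in> D i} \<subseteq> A i)"
      by metis
    have "inj_on D {..<n}"
    proof (rule inj_onI)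
      fix i j assume ij: "i \<in> {..<n}" "j \<in> {..<n}" "D i = D j"
      then have "A i \<inter> A j \<noteq> {}" using D[of i] D[of j] by auto
      then show "i = j" using disj by (auto simp: disjoint_family_on_def)
    qed
    then have card: "card (D ` {..<n}) = n" by (simp add: card_image)
    have "D ` {..<n} \<subseteq> unbounded_components (realization \<Gamma>) (Inl ` K)" using D by blast
    then have "n \<le> card U" if "finite U" "U = unbounded_components (realization \<Gamma>) (Inl ` K)" for U
      using card card_mono[OF that(1)] that(2) by metis
    then have "enat n \<le> ecard (unbounded_components (realization \<Gamma>) (Inl ` K))"
      by (simp add: ecard_def)
    moreover have "compactin (realization \<Gamma>) (Inl ` K)"
      using fin sub wf by (intro finite_imp_compactin)
        (auto simp: topspace_realization graph_points_def)
    ultimately show ?thesis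
      unfolding ends_def by (intro SUP_upper2) auto
  qed
  then show ?thesis
    by (metis enat_ord_simps(1) not_infinity_eq Suc_n_not_le_n)
qed


section \<open>Coset graphs\<close>

context group
begin

lemma verts_coset_graph: "verts (coset_graph G S H) = rcosets H"
  by (auto simp: coset_graph_def cayley_graph_def Let_def orbits_def orbit_def RCOSETS_def r_coset_def)

text \<open>\<open>H\<close> acts on the first coordinate only, so an edge orbit is a rectangle from
  which both the tail coset and the label can be read off.\<close>

lemma arcs_coset_graph: "arcs (coset_graph G S H) = (\<lambda>(X, s). X \<times> {s}) ` ((rcosets H) \<times> S)"
proof -
  have "orbit (G\<lparr>carrier := H\<rparr>) (\<lambda>h (g, s). (h \<otimes> g, s)) (g, s) = (H #> g) \<times> {s}" for g s :: 'a
    by (auto simp: orbit_def r_coset_def)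
  then have "arcs (coset_graph G S H) = (\<lambda>(g, s). (H #> g) \<times> {s}) ` (carrier G \<times> S)"
    by (auto simp: coset_graph_def cayley_graph_def Let_def orbits_def image_def)
  also have "\<dots> = (\<lambda>(X, s). X \<times> {s}) ` (((\<lambda>g. H #> g) ` carrier G) \<times> S)"
    by (auto simp: image_iff)
  also have "(\<lambda>g. H #> g) ` carrier G = rcosets H"
    by (auto simp: RCOSETS_def)
  finally show ?thesis .
qed

lemma tail_coset_graph: "X \<noteq> {} \<Longrightarrow> tail (coset_graph G S H) (X \<times> {s}) = X"
  by (simp add: coset_graph_def cayley_graph_def Let_def)

lemma head_coset_graph: "head (coset_graph G S H) (X \<times> {s}) = X #> s"
  by (auto simp: coset_graph_def cayley_graph_def Let_def r_coset_def)

context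
  fixes H assumes H: "subgroup H G"
begin

lemma rcosets_r_coset:
  assumes "X \<in> rcosets H" "g \<in> carrier G"
  shows "X #> g \<in> rcosets H"
  using assms subgroup.subset[OF H] by (auto simp: RCOSETS_def coset_mult_assoc)

lemma rcosets_subset_carrier: "X \<in> rcosets H \<Longrightarrow> X \<subseteq> carrier G"
  using r_coset_subset_G[OF subgroup.subset[OF H]] unfolding RCOSETS_def by blast

lemma rcosets_r_coset_inv:
  assumes "X \<in> rcosets H" "g \<in> carrier G"
  shows "X #> g #> inv g = X" "X #> inv g #> g = X"
  using assms by (simp_all add: coset_mult_assoc rcosets_subset_carrier)

lemma rcosets_nonempty: "X \<in> rcosets H \<Longrightarrow> X \<noteq> {}"
  using subgroup.one_closed[OF H] by (auto simp: RCOSETS_def r_coset_def)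

context
  fixes S assumes S: "finite_generating_set G S"
begin

lemma fin_gen: "finite S" "S \<subseteq> carrier G" "generate G S = carrier G"
  using S by (auto simp: finite_generating_set_def)

lemma arc_coset_graph_cases:
  assumes "e \<in> arcs (coset_graph G S H)"
  obtains X s where "e = X \<times> {s}" "X \<in> rcosets H" "s \<in> S" "s \<in> carrier G"
    "tail (coset_graph G S H) e = X" "head (coset_graph G S H) e = X #> s"
  using assms fin_gen(2)
  by (auto simp: arcs_coset_graph tail_coset_graph head_coset_graph rcosets_nonempty)

lemma wf_coset_graph: "wf_digraph (coset_graph G S H)"
  unfolding wf_digraph_def verts_coset_graph
proof (intro conjI allI impI)
  fix e assume "e \<in> arcs (coset_graph G S H)"
  then obtain X s where "X \<in> rcosets H" "s \<in> carrier G"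
      "tail (coset_graph G S H) e = X" "head (coset_graph G S H) e = X #> s"
    by (rule arc_coset_graph_cases)
  then show "tail (coset_graph G S H) e \<in> rcosets H" "head (coset_graph G S H) e \<in> rcosets H"
    by (simp_all add: rcosets_r_coset)
qed

text \<open>An arc with label s and head v has tail v s^-1; with the arcs starting at v, this bounds
  the degree by twice the number of labels.\<close>

lemma locally_finite_coset_graph:
  "finite {e \<in> arcs (coset_graph G S H).
     tail (coset_graph G S H) e = v \<or> head (coset_graph G S H) e = v}"
proof (rule finite_subset)
  show "{e \<in> arcs (coset_graph G S H).
      tail (coset_graph G S H) e = v \<or> head (coset_graph G S H) e = v}
    \<subseteq> (\<lambda>s. v \<times> {s}) ` S \<union> (\<lambda>s. (v #> inv s) \<times> {s}) ` S" (is "?L \<subseteq> ?R")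
  proof
    fix e assume e: "e \<in> ?L"
    then have "e \<in> arcs (coset_graph G S H)" by blast
    then obtain X s where X: "e = X \<times> {s}" "X \<in> rcosets H" "s \<in> S" "s \<in> carrier G"
        "tail (coset_graph G S H) e = X" "head (coset_graph G S H) e = X #> s"
      by (rule arc_coset_graph_cases)
    then have "X = v \<or> X = v #> inv s" using e rcosets_r_coset_inv(1)[of X s] by auto
    then show "e \<in> ?R" using X by blast
  qed
qed (use fin_gen(1) in auto)

text \<open>The inverse of a generator is realised by walking an arc backwards, hence the
  symmetrised relation. \<open>X\<close> stays arbitrary in the induction because the second factor
  of a product continues from the coset reached by the first.\<close>

lemma coset_graph_reachable:
  assumes "X \<in> rcosets H" "g \<in> carrier G"
  shows "(X, X #> g) \<in> (arcs_ends (coset_graph G S H) \<union> (arcs_ends (coset_graph G S H))\<inverse>)\<^sup>*"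
proof -
  have step: "(X, X #> s) \<in> arcs_ends (coset_graph G S H)" if "X \<in> rcosets H" "s \<in> S" for X s
    using that by (auto simp: arcs_ends_conv arcs_coset_graph tail_coset_graph head_coset_graph
        rcosets_nonempty image_iff intro!: bexI[of _ "X \<times> {s}"] bexI[of _ X] bexI[of _ s])
  have "g \<in> generate G S" using fin_gen(3) assms(2) by simp
  then show ?thesis using assms(1)
  proof (induction g arbitrary: X rule: generate.induct)
    case one
    then show ?case by (simp add: rcosets_subset_carrier)
  next
    case (incl s)
    then show ?case using step by blast
  next
    case (inv s)
    then have "s \<in> carrier G" using fin_gen(2) by blast
    then have "(X #> inv s, X) \<in> arcs_ends (coset_graph G S H)"
      using step[of "X #> inv s" s] inv by (simp add: rcosets_r_coset rcosets_r_coset_inv)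
    then show ?case by blast
  next
    case (eng g h)
    then have "g \<in> carrier G" "h \<in> carrier G" using fin_gen(3) by auto
    then have "X #> g \<in> rcosets H" "X #> (g \<otimes> h) = X #> g #> h"
      using eng.prems by (simp_all add: rcosets_r_coset coset_mult_assoc rcosets_subset_carrier)
    then show ?case
      using rtrancl_trans[OF eng.IH(1)[OF eng.prems] eng.IH(2)] by simp
  qed
qed

lemma connected_coset_graph:
  assumes "X \<in> rcosets H" "Y \<in> rcosets H"
  shows "(X, Y) \<in> (arcs_ends (coset_graph G S H) \<union> (arcs_ends (coset_graph G S H))\<inverse>)\<^sup>*"
proof -
  obtain a b where ab: "a \<in> carrier G" "X = H #> a" "b \<in> carrier G" "Y = H #> b"
    using assms by (auto simp: RCOSETS_def)
  then have "Y = X #> (inv a \<otimes> b)"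
    using subgroup.subset[OF H] by (simp add: coset_mult_assoc inv_solve_left m_assoc[symmetric])
  then show ?thesis
    using coset_graph_reachable[OF assms(1), of "inv a \<otimes> b"] ab by simp
qed

text \<open>Only arcs leaving \<open>A i\<close> are controlled, but for every group element: an arc
  labelled s that enters \<open>A i\<close> is, read backwards, one labelled \<open>inv s\<close>
  that leaves it.\<close>

theorem pair_ends_eq_infinity:
  fixes A :: "nat \<Rightarrow> 'a set set"
  assumes A: "\<And>i. A i \<subseteq> rcosets H" "\<And>i. infinite (A i)"
    and disj: "disjoint_family A"
    and cob: "\<And>i s. s \<in> carrier G \<Longrightarrow> finite {X \<in> A i. X #> s \<notin> A i}"
  shows "pair_ends G H S = \<infinity>"
  unfolding pair_ends_def
proof (rule ends_eq_infinity[OF wf_coset_graph locally_finite_coset_graph _ _ A(2) disj])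
  fix i
  let ?\<Gamma> = "coset_graph G S H"
  let ?out = "\<lambda>s. {X \<in> A i. X #> s \<notin> A i}"
  show "finite {e \<in> arcs ?\<Gamma>. (tail ?\<Gamma> e \<in> A i) \<noteq> (head ?\<Gamma> e \<in> A i)}"
  proof (rule finite_subset)
    show "{e \<in> arcs ?\<Gamma>. (tail ?\<Gamma> e \<in> A i) \<noteq> (head ?\<Gamma> e \<in> A i)}
      \<subseteq> (\<Union>s\<in>S. (\<lambda>X. X \<times> {s}) ` (?out s \<union> (\<lambda>X. X #> inv s) ` ?out (inv s)))"
    proof
      fix e assume "e \<in> {e \<in> arcs ?\<Gamma>. (tail ?\<Gamma> e \<in> A i) \<noteq> (head ?\<Gamma> e \<in> A i)}"
      then have arc: "e \<in> arcs ?\<Gamma>" and ne: "(tail ?\<Gamma> e \<in> A i) \<noteq> (head ?\<Gamma> e \<in> A i)" by auto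
      from arc obtain X s where e: "e = X \<times> {s}" "X \<in> rcosets H" "s \<in> S" "s \<in> carrier G"
          and th: "tail ?\<Gamma> e = X" "head ?\<Gamma> e = X #> s"
        by (rule arc_coset_graph_cases)
      have "X \<in> ?out s \<union> (\<lambda>X. X #> inv s) ` ?out (inv s)"
      proof (cases "X \<in> A i")
        case True
        then show ?thesis using ne th by simp
      next
        case False
        then have "X #> s \<in> ?out (inv s)" using e ne th by (simp add: rcosets_r_coset_inv)
        moreover have "X = X #> s #> inv s" using e by (simp add: rcosets_r_coset_inv)
        ultimately show ?thesis by blast
      qed
      then show "e \<in> (\<Union>s\<in>S. (\<lambda>X. X \<times> {s}) ` (?out s \<union> (\<lambda>X. X #> inv s) ` ?out (inv s)))"
        using e by blast
    qed
    show "finite (\<Union>s\<in>S. (\<lambda>X. X \<times> {s}) ` (?out s \<union> (\<lambda>X. X #> inv s) ` ?out (inv s)))"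
      using fin_gen cob by (intro finite_UN_I finite_imageI finite_UnI) (auto simp: subset_iff)
  qed
qed (use A connected_coset_graph in \<open>auto simp: verts_coset_graph\<close>)

end

end

end


section \<open>Maps that are affine on dyadic intervals\<close>

text \<open>Every interval \<open>[a/2\<^sup>K, (a+1)/2\<^sup>K)\<close> is mapped affinely onto a standard dyadic interval
  \<open>[c/2\<^sup>l, (c+1)/2\<^sup>l)\<close>; \<open>u\<close> is the relative position in these intervals.\<close>

definition dyadic_table :: "nat \<Rightarrow> (real \<Rightarrow> real) \<Rightarrow> bool" where
  "dyadic_table K h \<longleftrightarrow>
     (\<forall>a<2^K. \<exists>(c::int) l. \<forall>u\<in>{0..<1}. h ((real a + u) / 2^K) = (of_int c + u) / 2^l)"

text \<open>Arithmetic of nested intervals: piece r among the 2^m equal pieces of a standard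
  interval is again standard, with index \<open>c * 2^m + r\<close> at level
  \<open>l + m\<close>.\<close>

lemma dyadic_subdivide:
  fixes c :: int and l m :: nat and r v :: real
  shows "(of_int c + (r + v) / 2^m) / 2^l = (of_int (c * 2^m) + r + v) / 2^(l + m)"
  by (simp add: field_simps power_add)

lemma dyadic_fraction_bounds:
  fixes u :: real
  assumes "r < 2^m" "0 \<le> u" "u < 1"
  shows "(real r + u) / 2^m \<in> {0..<1}"
proof -
  have "real r + 1 \<le> 2^m"
    using assms(1) by (metis Suc_leI of_nat_Suc of_nat_le_iff of_nat_numeral of_nat_power add.commute)
  then show ?thesis using assms by simp
qed

lemma dyadic_table_mono:
  assumes "dyadic_table K h" "K \<le> L"
  shows "dyadic_table L h"
  unfolding dyadic_table_def
proof (intro allI impI)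
  fix b :: nat assume b: "b < 2^L"
  define m where "m = L - K"
  then have L: "L = K + m" using assms(2) by simp
  define a r where "a = b div 2^m" and "r = b mod 2^m"
  have ba: "b = a * 2^m + r" unfolding a_def r_def by (rule div_mult_mod_eq[symmetric])
  have r: "r < 2^m" by (simp add: r_def)
  have "a < 2^K" using b by (simp add: a_def L power_add less_mult_imp_div_less)
  then obtain c :: int and l where cl: "\<And>u. u \<in> {0..<1} \<Longrightarrow> h ((real a + u) / 2^K) = (of_int c + u) / 2^l"
    using assms(1) unfolding dyadic_table_def by blast
  have "h ((real b + u) / 2^L) = (of_int (c * 2^m + int r) + u) / 2^(l + m)" if u: "u \<in> {0..<1}" for u
  proof -
    have "(real b + u) / 2^L = (real a + (real r + u) / 2^m) / 2^K"
      using dyadic_subdivide[of "int a" "real r" u m K] by (simp add: ba L)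
    then have "h ((real b + u) / 2^L) = (of_int c + (real r + u) / 2^m) / 2^l"
      using cl[OF dyadic_fraction_bounds[OF r]] u by simp
    then show ?thesis by (simp add: dyadic_subdivide)
  qed
  then show "\<exists>(c::int) l. \<forall>u\<in>{0..<1}. h ((real b + u) / 2^L) = (of_int c + u) / 2^l" by blast
qed

lemma unit_interval_dyadic_cases:
  assumes "x \<in> {0..<1::real}"
  obtains a u where "a < 2^K" "u \<in> {0..<1}" "x = (real a + u) / 2^K"
proof
  define a where "a = nat \<lfloor>x * 2^K\<rfloor>"
  have pos: "0 \<le> x * 2^K" using assms by simp
  then have a: "real a = of_int \<lfloor>x * 2^K\<rfloor>" by (simp add: a_def)
  have "x * 2^K < 2^K" using assms by simp
  moreover have "real a \<le> x * 2^K" using a by linarith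
  ultimately have "real a < 2^K" by linarith
  then show "a < 2^K" by (metis of_nat_less_iff of_nat_numeral of_nat_power)
  show "x * 2^K - real a \<in> {0..<1}" using a by auto linarith+
  show "x = (real a + (x * 2^K - real a)) / 2^K" by simp
qed

text \<open>Standard dyadic intervals are nested or disjoint. At a level L beyond all target levels,
  each standard interval therefore lies inside one image interval, on which the inverse is affine
  with standard image.\<close>

lemma dyadic_table_inverse:
  assumes h: "dyadic_table K h" "{0..<1} \<subseteq> h ` {0..<1}"
    and g: "\<And>x. x \<in> {0..<1} \<Longrightarrow> g (h x) = x"
  shows "\<exists>L. dyadic_table L g"
proof -
  obtain c :: "nat \<Rightarrow> int" and l where cl:
    "\<And>a u. a < 2^K \<Longrightarrow> u \<in> {0..<1} \<Longrightarrow> h ((real a + u) / 2^K) = (of_int (c a) + u) / 2^l a"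
    using h(1) unfolding dyadic_table_def by metis
  define L where "L = (\<Sum>a<2^K. l a)"
  have "dyadic_table L g"
    unfolding dyadic_table_def
  proof (intro allI impI)
    fix b :: nat assume b: "b < 2^L"
    then have "real b / 2^L \<in> {0..<1}" using dyadic_fraction_bounds[of b L 0] by simp
    then obtain x where x: "x \<in> {0..<1}" "real b / 2^L = h x" using h(2) by blast
    obtain a u where a: "a < 2^K" "u \<in> {0..<1}" "x = (real a + u) / 2^K"
      using unit_interval_dyadic_cases[OF x(1)] .
    have "l a \<le> L" unfolding L_def using a(1) by (intro member_le_sum) auto
    define m where "m = L - l a"
    have L: "L = l a + m" using \<open>l a \<le> L\<close> by (simp add: m_def)
    have "real b / 2^L = (of_int (c a) + u) / 2^l a" using x(2) a cl by simp
    then have bu: "real b = of_int (c a * 2^m) + u * 2^m" by (simp add: L power_add field_simps)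
    \<comment> \<open>Position of interval b among the 2^m pieces of the image interval that
      contains its left end.\<close>
    define r where "r = int b - c a * 2^m"
    have r: "real_of_int r = u * 2^m" using bu by (simp add: r_def)
    then have "0 \<le> real_of_int r" "real_of_int r < 2^m" using a(2) by simp_all
    then have r0: "0 \<le> r" "nat r < 2^m" by (simp_all add: nat_less_iff)
    have "g ((real b + v) / 2^L) = (of_int (int a * 2^m + r) + v) / 2^(K + m)" if v: "v \<in> {0..<1}" for v
    proof -
      have w: "(real_of_int r + v) / 2^m \<in> {0..<1}"
        using dyadic_fraction_bounds[OF r0(2)] v r0(1) by simp
      have "(real b + v) / 2^L = (of_int (c a) + (real_of_int r + v) / 2^m) / 2^l a"
        using bu r by (simp add: dyadic_subdivide L)
      also have "\<dots> = h ((real a + (real_of_int r + v) / 2^m) / 2^K)"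
        using cl[OF a(1) w] by simp
      finally have "g ((real b + v) / 2^L) = (real a + (real_of_int r + v) / 2^m) / 2^K"
        using g[OF dyadic_fraction_bounds[OF a(1)]] w by simp
      then show ?thesis using dyadic_subdivide[of "int a" "real_of_int r" v m K] by simp
    qed
    then show "\<exists>(c::int) l. \<forall>v\<in>{0..<1}. g ((real b + v) / 2^L) = (of_int c + v) / 2^l" by blast
  qed
  then show ?thesis by blast
qed


section \<open>Ends of groups of dyadic bijections\<close>

text \<open>\<open>X\<close> is the set being permuted, [0,1] for F and [0,1) for T and V;
  \<open>Y\<close> is the prescribed fixed set, which \<open>fix_iff\<close> replaces by [0,1/2).
  Powers of \<open>p\<close> fill each side, powers of \<open>q\<close> separate the sides. Inverses
  are assumed explicitly, products come from \<open>S\<close>.\<close>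

locale dyadic_bij_group =
  fixes X Y :: "real set" and C :: "(real \<Rightarrow> real) set" and p q :: "real \<Rightarrow> real"
    and S :: "(real \<Rightarrow> real) set"
  assumes X: "{0..<1} \<subseteq> X" and C: "C \<subseteq> Bij X"
    and inverse: "\<And>h. h \<in> C \<Longrightarrow> restrict (inv_into X h) X \<in> C"
    and unit: "\<And>h. h \<in> C \<Longrightarrow> h ` {0..<1} = {0..<1}"
    and table: "\<And>h. h \<in> C \<Longrightarrow> \<exists>K. dyadic_table K h"
    and fix_iff: "\<And>h. h \<in> C \<Longrightarrow> (\<forall>x\<in>Y. h x = x) \<longleftrightarrow> (\<forall>x\<in>{0..<1/2}. h x = x)"
    and p: "p \<in> C" "\<And>x. x \<in> {0..<1/2} \<Longrightarrow> p x = x / 2"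
    and q: "q \<in> C" "q ` {0..<1/2} = {0..<1/2}" "\<And>x. x \<in> {0..<1/4} \<Longrightarrow> q x = x / 2"
    and S: "finite_generating_set ((BijGroup X)\<lparr>carrier := C\<rparr>) S"
begin

definition G :: "(real \<Rightarrow> real) monoid" where "G = (BijGroup X)\<lparr>carrier := C\<rparr>"

lemma carrier_G: "carrier G = C" by (simp add: G_def)

lemma subgroup_C: "subgroup C (BijGroup X)"
proof -
  interpret B: group "BijGroup X" by (rule group_BijGroup)
  have gen: "generate G S = C" "S \<subseteq> C"
    using S by (auto simp: finite_generating_set_def G_def)
  show ?thesis
  proof (rule B.subgroupI)
    show "C \<subseteq> carrier (BijGroup X)" using C by (simp add: BijGroup_def)
    show "C \<noteq> {}" using p by blast
    show "inv\<^bsub>BijGroup X\<^esub> a \<in> C" if "a \<in> C" for a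
      using that C inverse by (simp add: inv_BijGroup subset_iff)
    \<comment> \<open>\<open>generate\<close> is closed under products by definition and equals
      \<open>C\<close> by the hypothesis on \<open>S\<close>, so no composition of tables is
      computed.\<close>
    show "a \<otimes>\<^bsub>BijGroup X\<^esub> b \<in> C" if "a \<in> C" "b \<in> C" for a b
      using generate.eng[of a G S b] that gen(1) by (simp add: G_def)
  qed
qed

lemma group_G: "group G"
  unfolding G_def using subgroup.subgroup_is_group[OF subgroup_C group_BijGroup] .

interpretation G: group G by (rule group_G)

lemma unit_in: "f \<in> C \<Longrightarrow> x \<in> {0..<1} \<Longrightarrow> f x \<in> {0..<1}"
  using unit by blast

lemma in_X: "x \<in> {0..<1} \<Longrightarrow> x \<in> X"
  using X by blast

lemma mult_closed: "f \<in> C \<Longrightarrow> g \<in> C \<Longrightarrow> f \<otimes>\<^bsub>G\<^esub> g \<in> C"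
  using G.m_closed by (simp add: carrier_G)

lemma inv_closed: "f \<in> C \<Longrightarrow> inv\<^bsub>G\<^esub> f \<in> C"
  using G.inv_closed by (simp add: carrier_G)

lemma mult_apply: "f \<in> C \<Longrightarrow> g \<in> C \<Longrightarrow> x \<in> X \<Longrightarrow> (f \<otimes>\<^bsub>G\<^esub> g) x = f (g x)"
  using C by (auto simp: G_def BijGroup_def compose_def subset_iff)

lemma one_apply: "x \<in> X \<Longrightarrow> \<one>\<^bsub>G\<^esub> x = x"
  by (simp add: G_def BijGroup_def)

lemma inv_apply:
  assumes "f \<in> C" "x \<in> X"
  shows "(inv\<^bsub>G\<^esub> f) (f x) = x" "f ((inv\<^bsub>G\<^esub> f) x) = x"
  using mult_apply[of "inv\<^bsub>G\<^esub> f" f x] mult_apply[of f "inv\<^bsub>G\<^esub> f" x] assms one_apply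
    G.l_inv[of f] G.r_inv[of f] inv_closed by (simp_all add: carrier_G)

lemma pow_closed: "f \<in> C \<Longrightarrow> f [^]\<^bsub>G\<^esub> (n::nat) \<in> C"
  using G.nat_pow_closed by (simp add: carrier_G)

lemma pow_apply:
  assumes "f \<in> C" "x \<in> {0..<1}"
  shows "(f [^]\<^bsub>G\<^esub> (n::nat)) x = (f ^^ n) x"
  using assms(2)
proof (induction n arbitrary: x)
  case 0
  then show ?case by (simp add: one_apply in_X)
next
  case (Suc n)
  then show ?case
    using assms(1) unit_in[OF assms(1) Suc.prems]
    by (simp add: mult_apply pow_closed in_X funpow_swap1)
qed

definition H :: "(real \<Rightarrow> real) set" where "H = fixing_subgroup G Y"

lemma mem_H: "h \<in> H \<longleftrightarrow> h \<in> C \<and> (\<forall>x\<in>{0..<1/2}. h x = x)"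
  using fix_iff by (auto simp: H_def fixing_subgroup_def carrier_G)

lemma subgroup_H: "subgroup H G"
proof (rule G.subgroupI)
  show "H \<subseteq> carrier G" by (auto simp: mem_H carrier_G)
  show "H \<noteq> {}" using one_apply in_X G.one_closed by (force simp: mem_H carrier_G)
  show "inv\<^bsub>G\<^esub> a \<in> H" if a: "a \<in> H" for a
    unfolding mem_H
  proof (intro conjI ballI)
    fix x :: real assume x: "x \<in> {0..<1/2}"
    then have "(inv\<^bsub>G\<^esub> a) (a x) = x" using a in_X by (intro inv_apply) (auto simp: mem_H)
    then show "(inv\<^bsub>G\<^esub> a) x = x" using a x by (simp add: mem_H)
  qed (use a in \<open>simp add: mem_H inv_closed\<close>)
  show "a \<otimes>\<^bsub>G\<^esub> b \<in> H" if "a \<in> H" "b \<in> H" for a b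
    using that in_X by (auto simp: mem_H mult_closed mult_apply)
qed

text \<open>The coset of \<open>g\<close> is determined by the embedding \<open>g\<^sup>-\<^sup>1\<close> of \<open>[0,1/2)\<close>.\<close>

lemma coset_eq_iff:
  assumes g: "g \<in> C" "g' \<in> C"
  shows "H #>\<^bsub>G\<^esub> g = H #>\<^bsub>G\<^esub> g' \<longleftrightarrow> (\<forall>x\<in>{0..<1/2}. (inv\<^bsub>G\<^esub> g) x = (inv\<^bsub>G\<^esub> g') x)"
proof
  assume "H #>\<^bsub>G\<^esub> g = H #>\<^bsub>G\<^esub> g'"
  then obtain h where h: "h \<in> H" "g = h \<otimes>\<^bsub>G\<^esub> g'"
    using G.rcos_self[OF _ subgroup_H, of g] g by (auto simp: r_coset_def carrier_G)
  show "\<forall>x\<in>{0..<1/2}. (inv\<^bsub>G\<^esub> g) x = (inv\<^bsub>G\<^esub> g') x"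
  proof
    fix x :: real assume x: "x \<in> {0..<1/2}"
    have "inv\<^bsub>G\<^esub> h \<in> H" using h(1) subgroup.m_inv_closed[OF subgroup_H] by blast
    then have "(inv\<^bsub>G\<^esub> h) x = x" "inv\<^bsub>G\<^esub> h \<in> C" using x by (auto simp: mem_H)
    moreover have "inv\<^bsub>G\<^esub> g = inv\<^bsub>G\<^esub> g' \<otimes>\<^bsub>G\<^esub> inv\<^bsub>G\<^esub> h"
      using h g by (simp add: G.inv_mult_group carrier_G mem_H)
    ultimately show "(inv\<^bsub>G\<^esub> g) x = (inv\<^bsub>G\<^esub> g') x"
      using g x by (simp add: mult_apply inv_closed in_X)
  qed
next
  assume eq: "\<forall>x\<in>{0..<1/2}. (inv\<^bsub>G\<^esub> g) x = (inv\<^bsub>G\<^esub> g') x"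
  define h where "h = g' \<otimes>\<^bsub>G\<^esub> inv\<^bsub>G\<^esub> g"
  have "h \<in> H"
    unfolding mem_H using g eq in_X
    by (auto simp: h_def mult_closed inv_closed mult_apply inv_apply)
  moreover have "g' = h \<otimes>\<^bsub>G\<^esub> g"
    using g inv_closed[OF g(1)] G.m_assoc[of g' "inv\<^bsub>G\<^esub> g" g] G.l_inv[of g] G.r_one[of g']
    by (simp add: h_def carrier_G)
  ultimately have "g' \<in> H #>\<^bsub>G\<^esub> g" by (auto simp: r_coset_def)
  then show "H #>\<^bsub>G\<^esub> g = H #>\<^bsub>G\<^esub> g'"
    using G.repr_independence[OF _ _ subgroup_H] g by (simp add: carrier_G)
qed

lemma q_pow_image: "(q ^^ i) ` {0..<1/2} = {0..<1/2}"
proof (induction i)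
  case (Suc i)
  have "(q ^^ Suc i) ` {0..<1/2} = q ` (q ^^ i) ` {0..<1/2}" by (simp add: image_comp)
  then show ?case using Suc q(2) by simp
qed simp

lemma q_pow_in: "x \<in> {0..<1/2} \<Longrightarrow> (q ^^ i) x \<in> {0..<1/2}"
  using q_pow_image by blast

lemma q_pow_quarter:
  assumes "x \<in> {0..<1/4}"
  shows "(q ^^ i) x = x / 2^i"
proof (induction i)
  case (Suc i)
  have "x / 2^i \<le> x" using assms by (simp add: divide_le_eq mult_le_cancel_left1)
  moreover have "0 \<le> x / 2^i" "x < 1/4" using assms by auto
  ultimately have "x / 2^i \<in> {0..<1/4}" unfolding atLeastLessThan_iff by (blast intro: le_less_trans)
  then show ?case using Suc q(3)[of "x / 2^i"] by (simp del: atLeastLessThan_iff)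
qed simp

lemma p_pow_half:
  assumes "x \<in> {0..<1/2}"
  shows "(p ^^ k) x = x / 2^k"
proof (induction k)
  case (Suc k)
  have "x / 2^k \<le> x" using assms by (simp add: divide_le_eq mult_le_cancel_left1)
  moreover have "0 \<le> x / 2^k" "x < 1/2" using assms by auto
  ultimately have "x / 2^k \<in> {0..<1/2}" unfolding atLeastLessThan_iff by (blast intro: le_less_trans)
  then show ?case using Suc p(2)[of "x / 2^k"] by (simp del: atLeastLessThan_iff)
qed simp

text \<open>\<open>2 * x\<close> is the relative position of x in [0,1/2), so f after
  \<open>q^i\<close> carries [0,1/2) affinely onto the standard interval of level l and index c. For
  fixed i, the pair of c and l determines f on [0,1/2).\<close>

definition onto_dyadic :: "nat \<Rightarrow> (real \<Rightarrow> real) \<Rightarrow> int \<Rightarrow> nat \<Rightarrow> bool" where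
  "onto_dyadic i f c l \<longleftrightarrow> (\<forall>x\<in>{0..<1/2}. f ((q ^^ i) x) = (of_int c + 2 * x) / 2^l)"

definition A :: "nat \<Rightarrow> (real \<Rightarrow> real) set set" where
  "A i = {H #>\<^bsub>G\<^esub> g | g. g \<in> C \<and> (\<exists>c l. onto_dyadic i (inv\<^bsub>G\<^esub> g) c l)}"

lemma onto_dyadic_image:
  assumes "onto_dyadic i f c l"
  shows "f ` {0..<1/2} = {of_int c / 2^l..<(of_int c + 1) / 2^l}"
proof -
  have "f ` {0..<1/2} = f ` (q ^^ i) ` {0..<1/2}" by (simp add: q_pow_image)
  also have "\<dots> = (\<lambda>x. (of_int c + 2 * x) / 2^l) ` {0..<1/2}"
    using assms by (simp add: onto_dyadic_def image_image)
  also have "\<dots> = {of_int c / 2^l..<(of_int c + 1) / 2^l}"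
  proof (intro equalityI subsetI)
    fix y :: real assume "y \<in> {of_int c / 2^l..<(of_int c + 1) / 2^l}"
    then show "y \<in> (\<lambda>x. (of_int c + 2 * x) / 2^l) ` {0..<1/2}"
      by (intro image_eqI[of _ _ "(y * 2^l - of_int c) / 2"]) (auto simp: field_simps)
  qed (auto simp: divide_simps)
  finally show ?thesis .
qed

text \<open>Both conditions describe the same image, which forces equal lengths, that is l = m. Near
  0, \<open>q^i\<close> divides by 2^i, so f has slope 2^(i+1-l) at 0 by the first condition and
  2^(j+1-m) by the second.\<close>

lemma onto_dyadic_unique_index:
  assumes "onto_dyadic i f c l" "onto_dyadic j f d m" "i \<le> j"
  shows "i = j"
proof -
  have "{of_int c / 2^l..<(of_int c + 1) / 2^l} = {of_int d / 2^m..<(of_int d + 1) / (2^m :: real)}"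
    using onto_dyadic_image assms by metis
  moreover have "of_int c / 2^l < (of_int c + 1) / (2^l :: real)" by (simp add: divide_strict_right_mono)
  ultimately have e: "of_int c / 2^l = of_int d / (2^m :: real)"
      "(of_int c + 1) / 2^l = (of_int d + 1) / (2^m :: real)"
    by (auto simp: Ico_eq_Ico)
  then have lm: "1 / 2^l = 1 / (2^m :: real)" by (simp add: add_divide_distrib)
  obtain n where n: "j = i + n" using assms(3) le_Suc_ex by blast
  \<comment> \<open>Chosen so that \<open>q^i\<close> at x and \<open>q^j\<close> at 1/8 are the
    same point.\<close>
  define x :: real where "x = 1 / 8 / 2^n"
  have "(1::real) < 2 * 2^n" using one_le_power[of "2::real" n] by linarith
  then have x: "x \<in> {0..<1/4}" by (simp add: x_def divide_simps)
  have "f ((q ^^ i) x) = f ((q ^^ j) (1/8))"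
    using x by (simp add: q_pow_quarter x_def n power_add field_simps)
  then have "(of_int c + 2 * x) / 2^l = (of_int d + 2 * (1/8)) / 2^m"
    using assms(1,2) x by (simp add: onto_dyadic_def)
  then have "x * (1 / 2^l) = 1 / 8 * (1 / 2^m)" using e(1) by (simp add: add_divide_distrib)
  then have "x = 1 / 8" unfolding lm by (simp add: field_simps)
  then have "(2::real) ^ n = 2 ^ 0" by (simp add: x_def)
  then have "n = 0" by (rule power_inject_exp[THEN iffD1, rotated]) simp
  then show ?thesis using n by simp
qed

text \<open>Membership asks for some representative, but representatives of one coset have inverses
  that agree on [0,1/2), and \<open>q^i\<close> maps [0,1/2) into itself.\<close>

lemma mem_A_iff:
  assumes "g \<in> C"
  shows "H #>\<^bsub>G\<^esub> g \<in> A i \<longleftrightarrow> (\<exists>c l. onto_dyadic i (inv\<^bsub>G\<^esub> g) c l)"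
proof
  assume "H #>\<^bsub>G\<^esub> g \<in> A i"
  then obtain g' c l where g': "g' \<in> C" "H #>\<^bsub>G\<^esub> g = H #>\<^bsub>G\<^esub> g'" "onto_dyadic i (inv\<^bsub>G\<^esub> g') c l"
    unfolding A_def by blast
  then have "onto_dyadic i (inv\<^bsub>G\<^esub> g) c l"
    using coset_eq_iff[OF assms g'(1)] q_pow_in by (simp add: onto_dyadic_def)
  then show "\<exists>c l. onto_dyadic i (inv\<^bsub>G\<^esub> g) c l" by blast
qed (use assms in \<open>auto simp: A_def\<close>)

lemma A_subset: "A i \<subseteq> rcosets\<^bsub>G\<^esub> H"
  by (auto simp: A_def RCOSETS_def carrier_G)

lemma disjoint_A: "disjoint_family A"
  unfolding disjoint_family_on_def
proof (intro ballI impI)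
  fix i j :: nat assume "i \<noteq> j"
  show "A i \<inter> A j = {}"
  proof (rule ccontr)
    assume "A i \<inter> A j \<noteq> {}"
    then obtain g where "g \<in> C" "H #>\<^bsub>G\<^esub> g \<in> A i" "H #>\<^bsub>G\<^esub> g \<in> A j" by (auto simp: A_def)
    then show False
      using mem_A_iff onto_dyadic_unique_index \<open>i \<noteq> j\<close> by (metis nat_le_linear)
  qed
qed

lemma infinite_A: "infinite (A i)"
proof -
  \<comment> \<open>After \<open>q^i\<close> this becomes \<open>p^k\<close>, which maps [0,1/2)
    onto [0,2^-(k+1)); hence the level \<open>Suc k\<close> below.\<close>
  define f where "f k = p [^]\<^bsub>G\<^esub> (k::nat) \<otimes>\<^bsub>G\<^esub> inv\<^bsub>G\<^esub> (q [^]\<^bsub>G\<^esub> i)" for k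
  have fC: "f k \<in> C" for k using p q by (simp add: f_def mult_closed inv_closed pow_closed)
  have f: "f k ((q ^^ i) x) = x / 2^k" if x: "x \<in> {0..<1/2}" for k x
  proof -
    have x1: "x \<in> {0..<1}" using x by auto
    have "(q ^^ i) x = (q [^]\<^bsub>G\<^esub> i) x" using pow_apply[OF q(1) x1] by simp
    moreover have "(q [^]\<^bsub>G\<^esub> i) x \<in> X" using in_X unit_in[OF pow_closed[OF q(1)] x1] by blast
    ultimately have "f k ((q ^^ i) x) = (p [^]\<^bsub>G\<^esub> k) x"
      using p q x1 in_X by (simp add: f_def mult_apply inv_apply pow_closed inv_closed)
    then show ?thesis using pow_apply[OF p(1) x1] p_pow_half[OF x] by simp
  qed
  have inj: "inj (\<lambda>k. H #>\<^bsub>G\<^esub> inv\<^bsub>G\<^esub> (f k))"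
  proof (rule injI)
    fix k m assume "H #>\<^bsub>G\<^esub> inv\<^bsub>G\<^esub> (f k) = H #>\<^bsub>G\<^esub> inv\<^bsub>G\<^esub> (f m)"
    then have "\<forall>x\<in>{0..<1/2}. f k x = f m x"
      using coset_eq_iff[OF inv_closed inv_closed, OF fC fC] fC by (simp add: carrier_G)
    \<comment> \<open>One test point separates the cosets: the value there is 1/4 divided by
      2^k.\<close>
    then have "f k ((q ^^ i) (1/4)) = f m ((q ^^ i) (1/4))" using q_pow_in[of "1/4" i] by simp
    then have "(2::real)^k = 2^m" by (simp add: f)
    then show "k = m" by simp
  qed
  have "onto_dyadic i (f k) 0 (Suc k)" for k
    by (simp add: onto_dyadic_def f)
  then have "H #>\<^bsub>G\<^esub> inv\<^bsub>G\<^esub> (f k) \<in> A i" for k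
    using mem_A_iff[OF inv_closed[OF fC]] fC by (auto simp: carrier_G)
  then have "range (\<lambda>k. H #>\<^bsub>G\<^esub> inv\<^bsub>G\<^esub> (f k)) \<subseteq> A i" by blast
  then show ?thesis using range_inj_infinite[OF inj] infinite_super by blast
qed

lemma onto_dyadic_range:
  assumes "f \<in> C" "onto_dyadic i f c l"
  shows "0 \<le> c" "c < 2^l"
proof -
  have "(q ^^ i) 0 = 0" using q_pow_quarter[of 0 i] by simp
  then have "f 0 = of_int c / 2^l" using assms(2) by (force simp: onto_dyadic_def)
  then have "of_int c / 2^l \<in> {0..<1::real}" using unit_in[OF assms(1), of 0] by simp
  then have "0 \<le> (of_int c :: real)" "(of_int c :: real) < 2^l" 
    by (simp_all add: le_divide_eq divide_less_eq)
  then show "0 \<le> c" "c < 2^l" by simp_all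
qed

text \<open>Only the finitely many standard dyadic intervals longer than \<open>2\<^sup>-\<^sup>K\<close> can fail to be mapped
  affinely onto standard dyadic intervals by a map with a table of level \<open>K\<close>.\<close>

lemma finite_coboundary_A:
  assumes s: "s \<in> C"
  shows "finite {Z \<in> A i. Z #>\<^bsub>G\<^esub> s \<notin> A i}"
proof -
  obtain K where K: "dyadic_table K (inv\<^bsub>G\<^esub> s)" using table[OF inv_closed[OF s]] by blast
  \<comment> \<open>Each \<open>B (c, l)\<close> has at most one member: i, c and l prescribe the
    embedding on the image of \<open>q^i\<close>, which is all of [0,1/2).\<close>
  define B where "B = (\<lambda>(c, l). {H #>\<^bsub>G\<^esub> g | g. g \<in> C \<and> onto_dyadic i (inv\<^bsub>G\<^esub> g) c l})"
  have "{Z \<in> A i. Z #>\<^bsub>G\<^esub> s \<notin> A i} \<subseteq> (\<Union>b \<in> {0..<2^K} \<times> {..<K}. B b)"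
  proof
    fix Z assume "Z \<in> {Z \<in> A i. Z #>\<^bsub>G\<^esub> s \<notin> A i}"
    then obtain g c l where g: "g \<in> C" "Z = H #>\<^bsub>G\<^esub> g" "onto_dyadic i (inv\<^bsub>G\<^esub> g) c l"
      and nin: "Z #>\<^bsub>G\<^esub> s \<notin> A i"
      by (auto simp: A_def)
    have c: "0 \<le> c" "c < 2^l" using onto_dyadic_range[OF inv_closed[OF g(1)] g(3)] .
    have "l < K"
    proof (rule ccontr)
      assume "\<not> l < K"
      \<comment> \<open>At level l the interval with index c is a single row of the refined table,
        so the composite is again affine onto a standard interval.\<close>
      then have "dyadic_table l (inv\<^bsub>G\<^esub> s)" using dyadic_table_mono[OF K] by simp
      moreover have "nat c < 2^l" using c by (simp add: nat_less_iff)
      ultimately obtain d :: int and m where dm: "\<And>u. u \<in> {0..<1} \<Longrightarrow>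
          (inv\<^bsub>G\<^esub> s) ((real (nat c) + u) / 2^l) = (of_int d + u) / 2^m"
        unfolding dyadic_table_def by blast
      have "(inv\<^bsub>G\<^esub> (g \<otimes>\<^bsub>G\<^esub> s)) ((q ^^ i) x) = (of_int d + 2 * x) / 2^m" if x: "x \<in> {0..<1/2}" for x
      proof -
        have "(q ^^ i) x \<in> X" using q_pow_in[OF x, of i] in_X by simp
        then have "(inv\<^bsub>G\<^esub> (g \<otimes>\<^bsub>G\<^esub> s)) ((q ^^ i) x) = (inv\<^bsub>G\<^esub> s) ((inv\<^bsub>G\<^esub> g) ((q ^^ i) x))"
          using g s by (simp add: G.inv_mult_group carrier_G mult_apply inv_closed)
        then show ?thesis using g(3) x dm[of "2 * x"] c(1) by (simp add: onto_dyadic_def)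
      qed
      then have "H #>\<^bsub>G\<^esub> (g \<otimes>\<^bsub>G\<^esub> s) \<in> A i"
        using mem_A_iff[OF mult_closed[OF g(1) s]] by (auto simp: onto_dyadic_def)
      moreover have "Z #>\<^bsub>G\<^esub> s = H #>\<^bsub>G\<^esub> (g \<otimes>\<^bsub>G\<^esub> s)"
        using g s G.coset_mult_assoc[OF subgroup.subset[OF subgroup_H]] by (simp add: carrier_G)
      ultimately show False using nin by simp
    qed
    moreover have "c < 2^K"
      using c(2) power_increasing[of l K "2::int"] \<open>l < K\<close> by linarith
    ultimately show "Z \<in> (\<Union>b \<in> {0..<2^K} \<times> {..<K}. B b)"
      using g c by (intro UN_I[of "(c, l)"]) (auto simp: B_def)
  qed
  moreover have "finite (B b)" for b
  proof -
    have "Z = Z'" if Z: "Z \<in> B b" "Z' \<in> B b" for Z Z'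
    proof -
      obtain c l where b: "b = (c, l)" by (cases b)
      obtain g where g: "g \<in> C" "Z = H #>\<^bsub>G\<^esub> g" "onto_dyadic i (inv\<^bsub>G\<^esub> g) c l"
        using Z(1) by (auto simp: B_def b)
      obtain g' where g': "g' \<in> C" "Z' = H #>\<^bsub>G\<^esub> g'" "onto_dyadic i (inv\<^bsub>G\<^esub> g') c l"
        using Z(2) by (auto simp: B_def b)
      have "(inv\<^bsub>G\<^esub> g) y = (inv\<^bsub>G\<^esub> g') y" if y: "y \<in> {0..<1/2}" for y
      proof -
        obtain x where "x \<in> {0..<1/2}" "y = (q ^^ i) x" using q_pow_image[of i] y by blast
        then show ?thesis using g(3) g'(3) by (simp add: onto_dyadic_def)
      qed
      then show ?thesis using coset_eq_iff[OF g(1) g'(1)] g(2) g'(2) by blast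
    qed
    then have "B b \<subseteq> {Z}" if "Z \<in> B b" for Z using that by blast
    then show ?thesis by (metis finite.emptyI finite.insertI finite_subset ex_in_conv)
  qed
  ultimately show ?thesis by (meson finite_SigmaI finite_UN_I finite_atLeastLessThan_int finite_lessThan finite_subset)
qed

theorem pair_ends_infinity: "pair_ends G (fixing_subgroup G Y) S = \<infinity>"
  using G.pair_ends_eq_infinity[OF subgroup_H _ A_subset infinite_A disjoint_A] finite_coboundary_A S
  by (simp add: H_def[symmetric] carrier_G G_def[symmetric])

end


section \<open>Derivatives that are powers of two\<close>

text \<open>The right-hand side lies strictly between the consecutive powers 2^i and
  2^(i+1).\<close>

lemma power_int_two_gap:
  fixes i k :: int
  shows "2 powi k \<noteq> (3/2 * 2 powi i :: real)"
proof
  assume eq: "2 powi k = (3/2 * 2 powi i :: real)"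
  have pos: "(0::real) < 2 powi i" by simp
  show False
  proof (cases "k \<le> i")
    case True
    then have "2 powi k \<le> (2 powi i :: real)" by (intro power_int_increasing) auto
    then show False using pos eq by linarith
  next
    case False
    then have "2 powi (i + 1) \<le> (2 powi k :: real)" by (intro power_int_increasing) auto
    then show False using pos eq by (simp add: power_int_add)
  qed
qed

text \<open>Darboux: a derivative that only takes powers of two as values is constant, as it has the
  intermediate value property.\<close>

lemma powi_derivative_eq:
  fixes h :: "real \<Rightarrow> real"
  assumes J: "{x..y} \<subseteq> J" "x < y"
    and d: "\<And>t. t \<in> J \<Longrightarrow> (h has_real_derivative 2 powi (d t :: int)) (at t within J)"
  shows "d x = d y"
proof (rule ccontr)
  assume ne: "d x \<noteq> d y"
  \<comment> \<open>Strictly between the two slopes, and not a power of two.\<close>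
  define m :: real where "m = 3/2 * 2 powi (min (d x) (d y))"
  \<comment> \<open>The sign makes \<open>f\<close> decrease at x and increase at y, so its minimum
    over [x,y] is interior and its derivative vanishes there.\<close>
  define \<sigma> :: real where "\<sigma> = (if d x < d y then 1 else -1)"
  define f where "f t = \<sigma> * (h t - m * t)" for t
  have f': "(f has_real_derivative \<sigma> * (2 powi d t - m)) (at t within {x..y})" if "t \<in> {x..y}" for t
    unfolding f_def using J that
    by (auto intro!: derivative_eq_intros DERIV_subset[OF d])
  have lt: "3/2 * 2 powi i < (2 powi j :: real)" if "i < j" for i j :: int
  proof -
    have "3/2 * 2 powi i < (2 powi (i + 1) :: real)" by (simp add: power_int_add)
    also have "\<dots> \<le> 2 powi j" using that by (intro power_int_increasing) auto
    finally show ?thesis .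
  qed
  have pos: "(0::real) < 2 powi i" for i :: int by simp
  have signs: "\<sigma> * (2 powi d x - m) < 0" "0 < \<sigma> * (2 powi d y - m)"
    using ne lt[of "d x" "d y"] lt[of "d y" "d x"] pos[of "d x"] pos[of "d y"]
    by (auto simp: \<sigma>_def m_def min_def)
  have "continuous_on {x..y} f"
    using f' by (meson DERIV_continuous continuous_on_eq_continuous_within)
  then obtain z where z: "z \<in> {x..y}" "\<And>t. t \<in> {x..y} \<Longrightarrow> f z \<le> f t"
    using continuous_attains_inf[of "{x..y}" f] J(2) by auto
  have "z \<noteq> x"
  proof
    assume "z = x"
    obtain e where "e > 0" "\<And>s. s > 0 \<Longrightarrow> x + s \<in> {x..y} \<Longrightarrow> s < e \<Longrightarrow> f (x + s) < f x"
      using has_real_derivative_neg_dec_right[OF f' signs(1)] J(2) by auto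
    then have "f (x + min (e/2) (y - x)) < f x" using J(2) by (auto simp: min_def)
    moreover have "x + min (e/2) (y - x) \<in> {x..y}" using J(2) \<open>e > 0\<close> by auto
    ultimately show False using z(2) \<open>z = x\<close> by fastforce
  qed
  moreover have "z \<noteq> y"
  proof
    assume "z = y"
    obtain e where "e > 0" "\<And>s. s > 0 \<Longrightarrow> y - s \<in> {x..y} \<Longrightarrow> s < e \<Longrightarrow> f (y - s) < f y"
      using has_real_derivative_pos_inc_left[OF f' signs(2)] J(2) by auto
    then have "f (y - min (e/2) (y - x)) < f y" using J(2) by (auto simp: min_def)
    moreover have "y - min (e/2) (y - x) \<in> {x..y}" using J(2) \<open>e > 0\<close> by auto
    ultimately show False using z(2) \<open>z = y\<close> by fastforce
  qed
  ultimately have zi: "x < z" "z < y" using z(1) by auto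
  then have "(f has_real_derivative \<sigma> * (2 powi d z - m)) (at z)"
    using f'[OF z(1)] by (simp add: at_within_Icc_at)
  moreover have "\<forall>t. \<bar>z - t\<bar> < min (z - x) (y - z) \<longrightarrow> f z \<le> f t"
    using z(2) by (auto simp: abs_if split: if_splits)
  moreover have "0 < min (z - x) (y - z)" using zi by simp
  ultimately have "\<sigma> * (2 powi d z - m) = 0"
    by (intro DERIV_local_min[of f _ z "min (z - x) (y - z)"])
  then have "2 powi d z = m" by (simp add: \<sigma>_def split: if_splits)
  then show False unfolding m_def by (rule notE[OF power_int_two_gap])
qed

text \<open>With the exponent constant, subtracting the linear term leaves derivative zero on a
  convex set. In V this gives one formula on a maximal interval of differentiability that spans
  several rows of a table.\<close>

lemma powi_derivative_affine:
  fixes h :: "real \<Rightarrow> real"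
  assumes J: "is_interval J"
    and "\<And>t. t \<in> J \<Longrightarrow> \<exists>i::int. (h has_real_derivative 2 powi i) (at t within J)"
  shows "\<exists>(i::int) b. \<forall>t\<in>J. h t = 2 powi i * t + b"
proof -
  obtain d :: "real \<Rightarrow> int" where d: "\<And>t. t \<in> J \<Longrightarrow> (h has_real_derivative 2 powi d t) (at t within J)"
    using assms(2) by metis
  have "d x = d y" if "x \<in> J" "y \<in> J" "x < y" for x y
  proof -
    have "{x..y} \<subseteq> J" using mem_is_interval_1_I[OF J that(1,2)] by auto
    from this that(3) show ?thesis
      by (rule powi_derivative_eq[where J = J and h = h and d = d]) (rule d)
  qed
  then have const: "d x = d y" if "x \<in> J" "y \<in> J" for x y
    using that by (cases x y rule: linorder_cases) auto
  show ?thesis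
  proof (cases "J = {}")
    case False
    then obtain x0 where x0: "x0 \<in> J" by blast
    have "((\<lambda>t. h t - 2 powi d x0 * t) has_real_derivative 0) (at t within J)" if "t \<in> J" for t
      using d[OF that] const[OF that x0] by (auto intro!: derivative_eq_intros)
    then have "\<exists>b. \<forall>t\<in>J. h t - 2 powi d x0 * t = b"
      by (rule has_field_derivative_zero_constant[OF is_interval_convex[OF J]])
    then obtain b where "\<forall>t\<in>J. h t - 2 powi d x0 * t = b" by blast
    then have "\<forall>t\<in>J. h t = 2 powi d x0 * t + b" by (simp add: diff_eq_eq add.commute)
    then show ?thesis by blast
  qed auto
qed

text \<open>x is a limit point of \<open>J\<close>, so the derivative within \<open>J\<close> is
  unique. This covers x at the end of a piece: once differentiability is known there, one side
  decides the value.\<close>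

lemma affine_piece_derivative:
  fixes h :: "real \<Rightarrow> real"
  assumes J: "connected J" "J \<subseteq> A" "x \<in> J" "y \<in> J" "y \<noteq> x"
    and aff: "\<And>t. t \<in> J \<Longrightarrow> h t = m * t + b"
    and diff: "h differentiable (at x within A)"
  shows "(h has_real_derivative m) (at x within A)"
proof -
  obtain D where D: "(h has_real_derivative D) (at x within A)"
    using diff by (auto simp: real_differentiable_def)
  then have "(h has_real_derivative D) (at x within J)" using J(2) by (rule DERIV_subset)
  moreover have "((\<lambda>t. m * t + b) has_real_derivative m) (at x within J)"
    by (auto intro!: derivative_eq_intros)
  then have "(h has_real_derivative m) (at x within J)"
    by (rule has_field_derivative_transform_within[OF _ zero_less_one J(3)]) (simp add: aff)
  moreover have "at x within J \<noteq> bot"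
  proof -
    have "J \<noteq> {z}" for z using J(3,4,5) by auto
    then show ?thesis using connected_imp_perfect[OF J(1,3)] by (simp add: trivial_limit_within)
  qed
  ultimately have "D = m" unfolding has_field_derivative_iff by (rule tendsto_unique[rotated])
  then show ?thesis using D by simp
qed

lemma affine_closure:
  fixes h :: "real \<Rightarrow> real"
  assumes "continuous_on {l..r} h" "l < r" "\<And>t. t \<in> {l<..<r} \<Longrightarrow> h t = m * t + b" "t \<in> {l..r}"
  shows "h t = m * t + b"
proof -
  have cl: "closure {l<..<r} = {l..r}" using assms(2) by simp
  have "h t - m * t = b"
  proof (rule continuous_constant_on_closure[of "{l<..<r}" "\<lambda>t. h t - m * t"])
    show "continuous_on (closure {l<..<r}) (\<lambda>t. h t - m * t)"
      unfolding cl by (intro continuous_intros assms(1))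
    show "s \<in> {l<..<r} \<Longrightarrow> h s - m * s = b" for s using assms(3)[of s] by simp
    show "t \<in> closure {l<..<r}" unfolding cl by (rule assms(4))
  qed
  then show ?thesis by linarith
qed

lemma dyadic_point_in_unit_interval:
  assumes "a < 2^K"
  shows "0 \<le> real a / 2^K" "(real a + 1) / 2^K \<le> 1" "real a / 2^K < (real a + 1) / 2^K"
proof -
  have "real a + 1 \<le> 2^K"
    using assms by (metis Suc_leI of_nat_Suc of_nat_le_iff of_nat_numeral of_nat_power add.commute)
  then show "(real a + 1) / 2^K \<le> 1" by simp
qed (auto simp: divide_strict_right_mono)

lemma dyadic_table_affine:
  assumes "dyadic_table K h" "a < 2^K"
  shows "\<exists>(i::int) b. \<forall>x\<in>{real a / 2^K..<(real a + 1) / 2^K}. h x = 2 powi i * x + b"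
proof -
  obtain c :: int and l where cl: "\<And>u. u \<in> {0..<1} \<Longrightarrow> h ((real a + u) / 2^K) = (of_int c + u) / 2^l"
    using assms unfolding dyadic_table_def by blast
  have "h x = 2 powi (int K - int l) * x + (of_int c - real a) / 2^l"
    if x: "x \<in> {real a / 2^K..<(real a + 1) / 2^K}" for x
  proof -
    have "x * 2^K - real a \<in> {0..<1}" using x by (auto simp: field_simps)
    then have "h x = (of_int c + (x * 2^K - real a)) / 2^l" using cl[of "x * 2^K - real a"] by simp
    then show ?thesis by (simp add: power_int_diff add_divide_distrib diff_divide_distrib)
  qed
  then show ?thesis by blast
qed

text \<open>On an interval of level K + N, slope 2^i gives an image of length 2^-l with l = K + N -
  i. The image is standard if its left end is a multiple of 2^-l, which holds once l is at least
  \<open>n a\<close>.\<close>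

lemma dyadic_table_of_affine:
  assumes aff: "\<And>a. a < 2^K \<Longrightarrow>
      \<exists>(i::int) b. \<forall>x\<in>{real a / 2^K..<(real a + 1) / 2^K}. h x = 2 powi i * x + b"
    and dy: "\<And>a. a < 2^K \<Longrightarrow> \<exists>(z::int) n. h (real a / 2^K) = of_int z / 2^n"
  shows "\<exists>L. dyadic_table L h"
proof -
  obtain i :: "nat \<Rightarrow> int" and b where ib: "\<And>a x. a < 2^K \<Longrightarrow>
      x \<in> {real a / 2^K..<(real a + 1) / 2^K} \<Longrightarrow> h x = 2 powi i a * x + b a"
    using aff by metis
  obtain z :: "nat \<Rightarrow> int" and n where zn: "\<And>a. a < 2^K \<Longrightarrow> h (real a / 2^K) = of_int (z a) / 2^n a"
    using dy by metis
  \<comment> \<open>Dominates, for each row, the denominator exponent plus the size of the slope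
    exponent, so that l is natural and at least \<open>n a\<close>.\<close>
  define N where "N = (\<Sum>a<2^K. n a + nat \<bar>i a\<bar>)"
  have "dyadic_table (K + N) h"
    unfolding dyadic_table_def
  proof (intro allI impI)
    fix e :: nat assume e: "e < 2^(K + N)"
    define a r where "a = e div 2^N" and "r = e mod 2^N"
    have ea: "e = a * 2^N + r" unfolding a_def r_def by (rule div_mult_mod_eq[symmetric])
    have r: "r < 2^N" by (simp add: r_def)
    have a: "a < 2^K" using e by (simp add: a_def power_add less_mult_imp_div_less)
    have "n a + nat \<bar>i a\<bar> \<le> N" unfolding N_def using a by (intro member_le_sum) auto
    define l where "l = nat (int (K + N) - i a)"
    have l: "int l = int (K + N) - i a" "n a \<le> l"
      using \<open>n a + nat \<bar>i a\<bar> \<le> N\<close> by (auto simp: l_def)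
    have "h ((real e + u) / 2^(K + N)) = (of_int (z a * 2^(l - n a) + int r) + u) / 2^l"
      if u: "u \<in> {0..<1}" for u
    proof -
      define w where "w = (real r + u) / 2^N"
      have w: "w \<in> {0..<1}" using dyadic_fraction_bounds[OF r, of u] u by (simp add: w_def)
      have x: "(real e + u) / 2^(K + N) = real a / 2^K + w / 2^K"
        using dyadic_subdivide[of "int a" "real r" u N K] by (simp add: ea w_def add_divide_distrib)
      have "h (real a / 2^K + w / 2^K) = 2 powi i a * (real a / 2^K + w / 2^K) + b a"
        using w by (intro ib[OF a]) (auto simp: add_divide_distrib divide_strict_right_mono)
      moreover have "h (real a / 2^K) = 2 powi i a * (real a / 2^K) + b a"
        by (intro ib[OF a]) (simp add: divide_strict_right_mono)
      ultimately have "h ((real e + u) / 2^(K + N)) = of_int (z a) / 2^n a + 2 powi i a * (w / 2^K)"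
        using zn[OF a] unfolding x by (simp add: ring_distribs)
      also have "2 powi i a * (w / 2^K) = (real r + u) / 2^l"
      proof -
        have "(2::real)^l = 2 powi int l" by simp
        also have "\<dots> = 2^(K + N) / 2 powi i a"
          unfolding l(1) by (subst power_int_diff) (simp_all del: of_nat_add)
        finally show ?thesis by (simp add: w_def power_add mult.commute)
      qed
      also have "of_int (z a) / 2^n a = (of_int (z a) * 2^(l - n a) / 2^l :: real)"
        using l(2) by (simp add: power_diff)
      finally show ?thesis by (simp only: of_int_add of_int_mult of_int_power of_int_numeral
            of_int_of_nat_eq add_divide_distrib add.assoc)
    qed
    then show "\<exists>(c::int) m. \<forall>u\<in>{0..<1}. h ((real e + u) / 2^(K + N)) = (of_int c + u) / 2^m" by blast
  qed
  then show ?thesis by blast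
qed

section \<open>Dyadic grids in [0,1]\<close>

definition grid :: "nat \<Rightarrow> real set" where
  "grid K = (\<lambda>a. real a / 2^K) ` {..2^K}"

lemma finite_grid: "finite (grid K)" by (simp add: grid_def)

lemma grid_subset_dyadics: "grid K \<subseteq> dyadics"
  unfolding grid_def dyadics_def by blast

lemma grid_endpoints:
  assumes "a < 2^K"
  shows "real a / 2^K \<in> grid K" "(real a + 1) / 2^K \<in> grid K"
  using assms by (auto simp: grid_def image_iff intro!: bexI[of _ a] bexI[of _ "Suc a"])

lemma grid_open_interval:
  assumes "a < 2^K" "x \<in> {real a / 2^K<..<(real a + 1) / 2^K}"
  shows "x \<notin> grid K"
proof
  assume "x \<in> grid K"
  then obtain b where "x = real b / 2^K" by (auto simp: grid_def)
  then have "real a < real b" "real b < real (Suc a)" using assms(2) by (simp_all add: divide_less_cancel)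
  then have "a < b" "b < Suc a" by (simp_all only: of_nat_less_iff)
  then show False by simp
qed

lemma unit_interval_grid_cases:
  assumes "x \<in> {0..<1::real}"
  obtains a where "a < 2^K" "x \<in> {real a / 2^K..<(real a + 1) / 2^K}"
proof -
  obtain a u where "a < 2^K" "u \<in> {0..<1}" "x = (real a + u) / 2^K"
    using unit_interval_dyadic_cases[OF assms] .
  then show ?thesis using that[of a] by (auto simp: divide_right_mono divide_strict_right_mono)
qed

lemma avoid_grid_cases:
  assumes "x \<in> {0..1::real}" "x \<notin> grid K"
  obtains a where "a < 2^K" "x \<in> {real a / 2^K<..<(real a + 1) / 2^K}"
proof -
  have "1 \<in> grid K" by (auto simp: grid_def image_iff intro!: bexI[of _ "2^K"])
  then have "x \<in> {0..<1}" using assms by (cases "x = 1") auto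
  then obtain a where "a < 2^K" "x \<in> {real a / 2^K..<(real a + 1) / 2^K}"
    by (rule unit_interval_grid_cases)
  then show ?thesis using that[of a] assms(2) grid_endpoints[of a K] by (cases "x = real a / 2^K") auto
qed

lemma component_minus_grid:
  assumes J: "J \<in> components (A - grid K)" and A: "A \<subseteq> {0..1::real}"
  obtains a where "a < 2^K" "J \<subseteq> {real a / 2^K<..<(real a + 1) / 2^K}"
proof -
  have J': "connected J" "J \<noteq> {}" "J \<subseteq> A - grid K"
    using J by (auto simp: in_components_connected in_components_nonempty dest: in_components_subset)
  then obtain x where x: "x \<in> J" by blast
  obtain a where a: "a < 2^K" "x \<in> {real a / 2^K<..<(real a + 1) / 2^K}"
    using avoid_grid_cases[of x K] x J'(3) A by blast
  have "y \<in> {real a / 2^K<..<(real a + 1) / 2^K}" if y: "y \<in> J" for y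
  proof (rule ccontr)
    assume "y \<notin> {real a / 2^K<..<(real a + 1) / 2^K}"
    then consider "y \<le> real a / 2^K" | "(real a + 1) / 2^K \<le> y" by fastforce
    then have "real a / 2^K \<in> J \<or> (real a + 1) / 2^K \<in> J"
    proof cases
      case 1
      moreover have "real a / 2^K \<le> x" using a(2) by simp
      ultimately show ?thesis using connectedD_interval[OF J'(1) y x] by blast
    next
      case 2
      moreover have "x \<le> (real a + 1) / 2^K" using a(2) by simp
      ultimately show ?thesis using connectedD_interval[OF J'(1) x y] by blast
    qed
    then show False using grid_endpoints[OF a(1)] J'(3) by blast
  qed
  then show ?thesis using that a(1) by blast
qed

lemma dyadics_finite_subset_grid:
  assumes "finite D" "D \<subseteq> dyadics" "D \<subseteq> {0..1}"
  shows "\<exists>K. D \<subseteq> grid K"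
proof -
  have "\<forall>x\<in>D. \<exists>m k. x = real m / 2^k" using assms(2) unfolding dyadics_def by blast
  then obtain m k where mk: "\<And>x. x \<in> D \<Longrightarrow> x = real (m x) / 2^k x" by metis
  define K where "K = sum k D"
  have "x \<in> grid K" if x: "x \<in> D" for x
  proof -
    have "k x \<le> K" unfolding K_def using x assms(1) by (intro member_le_sum) auto
    then have e: "x = real (m x * 2^(K - k x)) / 2^K"
      by (subst mk[OF x], subst of_nat_mult, subst of_nat_power) (simp add: power_diff)
    moreover have "x \<le> 1" using x assms(3) by auto
    ultimately have "real (m x * 2^(K - k x)) \<le> 2^K" by (metis divide_le_eq_1_pos zero_less_numeral zero_less_power)
    then have "m x * 2^(K - k x) \<le> 2^K" by (metis of_nat_le_iff of_nat_numeral of_nat_power)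
    then show ?thesis unfolding grid_def using e by (intro image_eqI) auto
  qed
  then show ?thesis by blast
qed


section \<open>Thompson's group F\<close>

lemma unit_interval_closed_grid_cases:
  assumes "x \<in> {0..1::real}"
  obtains a where "a < 2^K" "x \<in> {real a / 2^K..(real a + 1) / 2^K}"
proof (cases "x = 1")
  case True
  then show ?thesis using that[of "2^K - 1"] by (simp add: of_nat_diff)
next
  case False
  then have "x \<in> {0..<1}" using assms by auto
  then obtain a where "a < 2^K" "x \<in> {real a / 2^K..<(real a + 1) / 2^K}"
    by (rule unit_interval_grid_cases)
  then show ?thesis using that[of a] by auto
qed

lemma unit_interval_left_open_grid_cases:
  assumes "x \<in> {0<..1::real}"
  obtains a where "a < 2^K" "x \<in> {real a / 2^K<..(real a + 1) / 2^K}"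
proof -
  have "1 - x \<in> {0..<1}" using assms by auto
  then obtain a u where a: "a < 2^K" "u \<in> {0..<1}" "1 - x = (real a + u) / 2^K"
    by (rule unit_interval_dyadic_cases)
  define b where "b = 2^K - 1 - a"
  have b: "b < 2^K" "real b = 2^K - 1 - real a" using a(1) by (auto simp: b_def of_nat_diff)
  have "x = 1 - (real a + u) / 2^K" using a(3) by linarith
  also have "\<dots> = (real b + (1 - u)) / 2^K" by (simp add: b(2) diff_divide_distrib add_divide_distrib)
  finally have "x = (real b + (1 - u)) / 2^K" .
  then show ?thesis using that[OF b(1)] a(2) by (simp add: divide_strict_right_mono divide_right_mono)
qed

section \<open>Regularity of maps with a dyadic table\<close>

lemma dyadic_table_closed_affine:
  assumes "dyadic_table K h" "continuous_on {0..1} h" "a < 2^K"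
  shows "\<exists>(i::int) b. \<forall>x\<in>{real a / 2^K..(real a + 1) / 2^K}. h x = 2 powi i * x + b"
proof -
  let ?l = "real a / 2^K" and ?r = "(real a + 1) / 2^K"
  obtain i :: int and b where ib: "\<forall>x\<in>{?l..<?r}. h x = 2 powi i * x + b"
    using dyadic_table_affine[OF assms(1,3)] by blast
  have bounds: "0 \<le> ?l" "?r \<le> 1" "?l < ?r" using dyadic_point_in_unit_interval[OF assms(3)] .
  then have "continuous_on {?l..?r} h" using continuous_on_subset[OF assms(2)] by auto
  then have "h x = 2 powi i * x + b" if "x \<in> {?l..?r}" for x
    by (rule affine_closure[OF _ bounds(3) _ that]) (use ib in auto)
  then show ?thesis by blast
qed

lemma dyadic_table_differentiable:
  assumes "dyadic_table K h" "x \<in> {0..1}" "x \<notin> grid K"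
  shows "h differentiable (at x within A)"
proof -
  obtain a where a: "a < 2^K" "x \<in> {real a / 2^K<..<(real a + 1) / 2^K}"
    using avoid_grid_cases[OF assms(2,3)] .
  obtain i :: int and b where
    ib: "\<forall>x\<in>{real a / 2^K..<(real a + 1) / 2^K}. h x = 2 powi i * x + b"
    using dyadic_table_affine[OF assms(1) a(1)] by blast
  have "((\<lambda>x. 2 powi i * x + b) has_real_derivative 2 powi i) (at x)"
    by (auto intro!: derivative_eq_intros)
  then have "(h has_real_derivative 2 powi i) (at x)"
    by (rule has_field_derivative_transform_within_open[OF _ open_greaterThanLessThan a(2)])
      (use ib in auto)
  then show ?thesis
    using real_differentiable_def differentiable_at_withinI by blast
qed

lemma nondiff_points_subset_grid:
  assumes "dyadic_table K h" "A \<subseteq> {0..1}"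
  shows "nondiff_points A h \<subseteq> grid K"
proof
  fix x assume "x \<in> nondiff_points A h"
  then have "x \<in> {0..1}" "\<not> h differentiable (at x within A)"
    using assms(2) by (auto simp: nondiff_points_def)
  then show "x \<in> grid K" using dyadic_table_differentiable[OF assms(1)] by blast
qed

lemma piecewise_linear_on_dyadic_table:
  assumes "dyadic_table K h" "A \<subseteq> {0..1}"
  shows "piecewise_linear_on A h"
  unfolding piecewise_linear_on_def
proof (intro exI[of _ "grid K"] conjI ballI)
  show "finite (grid K)" by (rule finite_grid)
  fix J assume "J \<in> components (A - grid K)"
  then obtain a where a: "a < 2^K" "J \<subseteq> {real a / 2^K<..<(real a + 1) / 2^K}"
    using component_minus_grid[OF _ assms(2)] by blast
  obtain i :: int and b where
    "\<forall>x\<in>{real a / 2^K..<(real a + 1) / 2^K}. h x = 2 powi i * x + b"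
    using dyadic_table_affine[OF assms(1) a(1)] by blast
  moreover have "J \<subseteq> {real a / 2^K..<(real a + 1) / 2^K}" using a(2) by auto
  ultimately show "\<exists>m b. \<forall>x\<in>J. h x = m * x + b" by blast
qed

text \<open>Crossing a piece of slope 2^i from one grid point to the next adds 2^i / 2^K to the
  value; this is the induction step along the grid below.\<close>

lemma signed_dyadic_add_powi:
  assumes "\<exists>(z::int) n. x = real_of_int z / 2^n"
  shows "\<exists>(z::int) n. x + 2 powi i / 2^K = real_of_int z / 2^n"
proof -
  obtain z n where x: "x = real_of_int z / 2^n" using assms by blast
  show ?thesis
  proof (cases "0 \<le> i")
    case True
    then have "x + 2 powi i / 2^K = real_of_int (z * 2^K + 2^nat i * 2^n) / 2^(n + K)"
      by (simp add: x power_int_def power_add field_simps)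
    then show ?thesis by blast
  next
    case False
    then have "x + 2 powi i / 2^K = real_of_int (z * 2^(K + nat (-i)) + 2^n) / 2^(n + (K + nat (-i)))"
      by (simp add: x power_int_def power_add field_simps)
    then show ?thesis by blast
  qed
qed

text \<open>Closed pieces share their endpoints, so values at grid points differ from
  \<open>h 0\<close> by sums of terms 2^i / 2^K. Used for F and for the lifts in T; the jumps of V
  break this chain.\<close>

lemma dyadic_table_of_closed_affine:
  assumes aff: "\<And>a. a < 2^K \<Longrightarrow>
      \<exists>(i::int) b. \<forall>x\<in>{real a / 2^K..(real a + 1) / 2^K}. h x = 2 powi i * x + b"
    and h0: "\<exists>(z::int) n. h 0 = of_int z / 2^n"
  shows "\<exists>L. dyadic_table L h"
proof (rule dyadic_table_of_affine)
  show "\<exists>(i::int) b. \<forall>x\<in>{real a / 2^K..<(real a + 1) / 2^K}. h x = 2 powi i * x + b"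
    if "a < 2^K" for a
    using aff[OF that] by (meson atLeastAtMost_iff atLeastLessThan_iff less_imp_le)
  show "\<exists>(z::int) n. h (real a / 2^K) = of_int z / 2^n" if "a < 2^K" for a
    using that
  proof (induction a)
    case 0
    then show ?case using h0 by simp
  next
    case (Suc a)
    then have a: "a < 2^K" by simp
    then obtain i :: int and b where
      ib: "\<forall>x\<in>{real a / 2^K..(real a + 1) / 2^K}. h x = 2 powi i * x + b"
      using aff by blast
    have "h (real (Suc a) / 2^K) = 2 powi i * ((real a + 1) / 2^K) + b"
      using ib by (simp add: divide_right_mono add.commute)
    moreover have "h (real a / 2^K) = 2 powi i * (real a / 2^K) + b"
      using ib by (simp add: divide_right_mono)
    ultimately have "h (real (Suc a) / 2^K) = h (real a / 2^K) + 2 powi i / 2^K"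
      by (simp add: add_divide_distrib ring_distribs)
    then show ?case using signed_dyadic_add_powi[OF Suc.IH[OF a]] by simp
  qed
qed

lemma homeomorphic_map_unit_interval:
  assumes "homeomorphic_map (top_of_set {0..1}) (top_of_set {0..1}) (h :: real \<Rightarrow> real)"
  shows "continuous_on {0..1} h" "bij_betw h {0..1} {0..1}"
proof -
  show "continuous_on {0..1} h"
    using homeomorphic_imp_continuous_map[OF assms] by (simp add: continuous_map_in_subtopology)
  show "bij_betw h {0..1} {0..1}"
    using homeomorphic_imp_surjective_map[OF assms] homeomorphic_imp_injective_map[OF assms]
    by (simp add: bij_betw_def)
qed

text \<open>Here F is seen to preserve orientation. Slopes are positive on each piece, so a preimage
  of 0 other than 0 would have a point to its left with negative value; dually for 1.\<close>

lemma unit_interval_endpoints_fixed: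
  assumes h: "bij_betw h {0..1::real} {0..1::real}"
    and aff: "\<And>a. a < 2^K \<Longrightarrow>
      \<exists>(i::int) b. \<forall>x\<in>{real a / 2^K..(real a + 1) / 2^K}. h x = 2 powi i * x + b"
  shows "h 0 = 0" "h 1 = 1"
proof -
  have incr: "h x < h y" if a: "a < 2^K" and xy: "x \<in> {real a / 2^K..(real a + 1) / 2^K}"
      "y \<in> {real a / 2^K..(real a + 1) / 2^K}" "x < y" for a x y
  proof -
    obtain i :: int and b where
      "\<forall>x\<in>{real a / 2^K..(real a + 1) / 2^K}. h x = 2 powi i * x + b"
      using aff[OF a] by blast
    then show ?thesis using xy by simp
  qed
  have range: "h x \<in> {0..1}" if "x \<in> {0..1}" for x
    using h that by (auto simp: bij_betw_def)
  show "h 0 = 0"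
  proof -
    have "0 \<in> h ` {0..1}" using h by (simp add: bij_betw_def)
    then obtain x where x: "x \<in> {0..1}" "h x = 0" by (metis imageE)
    have "x = 0"
    proof (rule ccontr)
      assume "x \<noteq> 0"
      then have "x \<in> {0<..1}" using x by auto
      then obtain a where a: "a < 2^K" "x \<in> {real a / 2^K<..(real a + 1) / 2^K}"
        by (rule unit_interval_left_open_grid_cases)
      then have "h (real a / 2^K) < h x"
        by (intro incr[OF a(1)]) (auto simp: divide_right_mono)
      moreover have "0 \<le> h (real a / 2^K)"
      proof -
        have "real a / 2^K \<in> {0..1}"
          unfolding atLeastAtMost_iff using dyadic_point_in_unit_interval[OF a(1)] by linarith
        then show ?thesis using range[of "real a / 2^K"] by (simp only: atLeastAtMost_iff)
      qed
      ultimately show False using x(2) by linarith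
    qed
    then show ?thesis using x by simp
  qed
  show "h 1 = 1"
  proof -
    have "1 \<in> h ` {0..1}" using h by (simp add: bij_betw_def)
    then obtain x where x: "x \<in> {0..1}" "h x = 1" by (metis imageE)
    have "x = 1"
    proof (rule ccontr)
      assume "x \<noteq> 1"
      then have "x \<in> {0..<1}" using x by auto
      then obtain a where a: "a < 2^K" "x \<in> {real a / 2^K..<(real a + 1) / 2^K}"
        by (rule unit_interval_grid_cases)
      then have "h x < h ((real a + 1) / 2^K)"
        by (intro incr[OF a(1)]) (auto simp: divide_right_mono)
      moreover have "h ((real a + 1) / 2^K) \<le> 1"
      proof -
        have "(real a + 1) / 2^K \<in> {0..1}"
          unfolding atLeastAtMost_iff using dyadic_point_in_unit_interval[OF a(1)] by linarith
        then show ?thesis using range[of "(real a + 1) / 2^K"] by (simp only: atLeastAtMost_iff)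
      qed
      ultimately show False using x(2) by linarith
    qed
    then show ?thesis using x by simp
  qed
qed

lemma thompson_F_I:
  assumes ext: "h \<in> extensional {0..1}"
    and hom: "homeomorphic_map (top_of_set {0..1}) (top_of_set {0..1}) h"
    and tab: "dyadic_table K h"
  shows "h \<in> carrier thompson_F"
proof -
  have cont: "continuous_on {0..1} h" using homeomorphic_map_unit_interval[OF hom] by blast
  have sub: "nondiff_points {0..1} h \<subseteq> grid K" by (rule nondiff_points_subset_grid[OF tab order_refl])
  have "\<exists>i::int. (h has_real_derivative 2 powi i) (at x within {0..1})"
    if x: "x \<in> {0..1} - nondiff_points {0..1} h" for x
  proof -
    have diff: "h differentiable (at x within {0..1})" using x by (auto simp: nondiff_points_def)
    obtain a where a: "a < 2^K" "x \<in> {real a / 2^K..(real a + 1) / 2^K}" (is "x \<in> {?l..?r}")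
      using unit_interval_closed_grid_cases x by blast
    obtain i :: int and b where ib: "\<forall>x\<in>{?l..?r}. h x = 2 powi i * x + b"
      using dyadic_table_closed_affine[OF tab cont a(1)] by blast
    have lr: "0 \<le> ?l" "?r \<le> 1" "?l < ?r" using dyadic_point_in_unit_interval[OF a(1)] .
    have "{?l..?r} \<subseteq> {0..1}" using lr by auto
    moreover obtain y where "y \<in> {?l..?r}" "y \<noteq> x"
      using lr(3) by (metis atLeastAtMost_iff less_imp_le order_less_irrefl order_refl)
    ultimately have "(h has_real_derivative 2 powi i) (at x within {0..1})"
      using affine_piece_derivative[OF connected_Icc _ a(2) _ _ _ diff] ib by blast
    then show ?thesis by blast
  qed
  then show ?thesis
    using ext hom sub piecewise_linear_on_dyadic_table[OF tab order_refl]
      finite_subset[OF sub finite_grid] grid_subset_dyadics[of K]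
    unfolding thompson_F_def by auto
qed

text \<open>A grid containing all points of nondifferentiability leaves open pieces where every
  derivative is a power of two. These are affine, and continuity reaches their endpoints.\<close>

lemma thompson_F_closed_affine:
  assumes h: "h \<in> carrier thompson_F"
  shows "\<exists>K. \<forall>a<2^K. \<exists>(i::int) b. \<forall>x\<in>{real a / 2^K..(real a + 1) / 2^K}. h x = 2 powi i * x + b"
proof -
  define D where "D = nondiff_points {0..1} h"
  have hom: "homeomorphic_map (top_of_set {0..1}) (top_of_set {0..1}) h"
    and D: "finite D" "D \<subseteq> dyadics" "D \<subseteq> {0..1}"
    and deriv: "\<And>x. x \<in> {0..1} - D \<Longrightarrow> \<exists>i::int. (h has_real_derivative 2 powi i) (at x within {0..1})"
    using h by (auto simp: thompson_F_def D_def nondiff_points_def)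
  have cont: "continuous_on {0..1} h" using homeomorphic_map_unit_interval[OF hom] by blast
  obtain K where K: "D \<subseteq> grid K" using dyadics_finite_subset_grid[OF D] by blast
  have "\<exists>(i::int) b. \<forall>x\<in>{real a / 2^K..(real a + 1) / 2^K}. h x = 2 powi i * x + b"
    if a: "a < 2^K" for a
  proof -
    let ?l = "real a / 2^K" and ?r = "(real a + 1) / 2^K"
    have lr: "0 \<le> ?l" "?r \<le> 1" "?l < ?r" using dyadic_point_in_unit_interval[OF a] .
    have sub: "{?l<..<?r} \<subseteq> {0..1}"
      unfolding subset_iff greaterThanLessThan_iff atLeastAtMost_iff using lr(1,2) by linarith
    have "\<exists>i::int. (h has_real_derivative 2 powi i) (at x within {?l<..<?r})" if x: "x \<in> {?l<..<?r}" for x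
    proof -
      have "x \<in> {0..1} - D" using x sub K grid_open_interval[OF a x] by blast
      then show ?thesis using deriv DERIV_subset[OF _ sub] by blast
    qed
    then obtain i :: int and b where ib: "\<forall>x\<in>{?l<..<?r}. h x = 2 powi i * x + b"
      using powi_derivative_affine[of "{?l<..<?r}" h] is_interval_oo by blast
    have "continuous_on {?l..?r} h" using continuous_on_subset[OF cont] lr by auto
    then have "h x = 2 powi i * x + b" if "x \<in> {?l..?r}" for x
      by (rule affine_closure[OF _ lr(3) _ that]) (use ib in auto)
    then show ?thesis by blast
  qed
  then show ?thesis by blast
qed

lemma thompson_F_E:
  assumes h: "h \<in> carrier thompson_F"
  shows "h \<in> extensional {0..1}"
    and "homeomorphic_map (top_of_set {0..1}) (top_of_set {0..1}) h"
    and "\<exists>K. dyadic_table K h"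
    and "continuous_on {0..1} h" "bij_betw h {0..1} {0..1}" "h 1 = 1"
proof -
  show "h \<in> extensional {0..1}"
    and hom: "homeomorphic_map (top_of_set {0..1}) (top_of_set {0..1}) h"
    using h by (auto simp: thompson_F_def)
  show "continuous_on {0..1} h" and bij: "bij_betw h {0..1} {0..1}"
    using homeomorphic_map_unit_interval[OF hom] by auto
  obtain K where K: "\<And>a. a < 2^K \<Longrightarrow>
      \<exists>(i::int) b. \<forall>x\<in>{real a / 2^K..(real a + 1) / 2^K}. h x = 2 powi i * x + b"
    using thompson_F_closed_affine[OF h] by blast
  show "h 1 = 1" using unit_interval_endpoints_fixed(2)[OF bij K] .
  have "h 0 = of_int 0 / 2^0" using unit_interval_endpoints_fixed(1)[OF bij K] by simp
  then have "\<exists>(z::int) n. h 0 = of_int z / 2^n" by (intro exI)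
  with K show "\<exists>K. dyadic_table K h" by (rule dyadic_table_of_closed_affine)
qed

lemma thompson_F_unit:
  assumes "h \<in> carrier thompson_F"
  shows "bij_betw h {0..<1} {0..<1}"
proof -
  have "bij_betw h ({0..1} - {1}) ({0..1} - {h 1})"
    using thompson_F_E(5)[OF assms] by (intro bij_betw_DiffI) (auto simp: bij_betw_def)
  moreover have "{0..1} - {1} = {0..<1::real}" by auto
  ultimately show ?thesis using thompson_F_E(6)[OF assms] by simp
qed

lemma thompson_F_inverse:
  assumes h: "h \<in> carrier thompson_F"
  shows "restrict (inv_into {0..1} h) {0..1} \<in> carrier thompson_F"
proof -
  let ?g = "restrict (inv_into {0..1} h) {0..1}"
  note hE = thompson_F_E[OF h]
  obtain g where g: "homeomorphic_maps (top_of_set {0..1}) (top_of_set {0..1}) h g"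
    using hE(2) by (auto simp: homeomorphic_map_maps)
  have eq: "?g y = g y" if "y \<in> {0..1}" for y
  proof -
    have "g y \<in> {0..1}" "h (g y) = y"
      using g that by (auto simp: homeomorphic_maps_def continuous_map_in_subtopology)
    then show ?thesis using that hE(5) inv_into_f_eq[of h "{0..1}" "g y" y] by (simp add: bij_betw_def)
  qed
  have "homeomorphic_map (top_of_set {0..1}) (top_of_set {0..1}) g"
    using g by (simp add: homeomorphic_maps_map)
  then have hom: "homeomorphic_map (top_of_set {0..1}) (top_of_set {0..1}) ?g"
    by (rule homeomorphic_map_eq) (use eq in simp)
  obtain K where K: "dyadic_table K h" using hE(3) by blast
  have "\<exists>L. dyadic_table L ?g"
  proof (rule dyadic_table_inverse[OF K])
    show "{0..<1} \<subseteq> h ` {0..<1}" using thompson_F_unit[OF h] by (simp add: bij_betw_def)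
    fix x :: real assume x: "x \<in> {0..<1}"
    then have "h x \<in> {0..<1}" using thompson_F_unit[OF h] by (auto simp: bij_betw_def)
    then show "?g (h x) = x" using hE(5) x by (simp add: bij_betw_def)
  qed
  then show ?thesis using thompson_F_I[OF _ hom] by auto
qed


section \<open>Thompson's group V\<close>

lemma dyadic_table_cong:
  assumes "dyadic_table K h" "\<And>x. x \<in> {0..<1} \<Longrightarrow> g x = h x"
  shows "dyadic_table K g"
  unfolding dyadic_table_def
proof (intro allI impI)
  fix a :: nat assume a: "a < 2^K"
  then obtain c :: int and l where "\<forall>u\<in>{0..<1}. h ((real a + u) / 2^K) = (of_int c + u) / 2^l"
    using assms(1) unfolding dyadic_table_def by blast
  moreover have "g ((real a + u) / 2^K) = h ((real a + u) / 2^K)" if "u \<in> {0..<1}" for u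
    using assms(2) dyadic_fraction_bounds[OF a, of u] that by simp
  ultimately show "\<exists>(c::int) l. \<forall>u\<in>{0..<1}. g ((real a + u) / 2^K) = (of_int c + u) / 2^l" by auto
qed

text \<open>At level K + k the point m/2^k is the left end of a row, so its image is the left end of
  a standard interval. The sign condition is there because \<open>dyadics\<close> contains only
  nonnegative numbers.\<close>

lemma dyadic_table_dyadics:
  assumes tab: "dyadic_table K h" and x: "x \<in> dyadics \<inter> {0..<1}" and pos: "0 \<le> h x"
  shows "h x \<in> dyadics"
proof -
  obtain m k where mk: "x = real m / 2^k" using x unfolding dyadics_def by blast
  define a where "a = m * 2^K"
  have xa: "x = real a / 2^(K + k)" by (simp add: mk a_def power_add)
  then have "real a < 2^(K + k)" using x by simp
  then have a: "a < 2^(K + k)" by (metis of_nat_less_iff of_nat_numeral of_nat_power)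
  have "dyadic_table (K + k) h" using dyadic_table_mono[OF tab] by simp
  then obtain c :: int and l where "\<forall>u\<in>{0..<1}. h ((real a + u) / 2^(K + k)) = (of_int c + u) / 2^l"
    using a unfolding dyadic_table_def by blast
  then have hx: "h x = of_int c / 2^l" using xa by force
  then have "0 \<le> (of_int c :: real)" using pos by (simp add: le_divide_eq)
  then have "h x = of_nat (nat c) / 2^l" using hx by simp
  then show ?thesis unfolding dyadics_def by blast
qed

text \<open>Counterpart of \<open>affine_closure\<close> for V, where continuity reaches only the
  left end of a piece.\<close>

lemma right_continuous_affine:
  fixes h :: "real \<Rightarrow> real"
  assumes "continuous (at_right l) h" "l < r" "\<And>t. t \<in> {l<..<r} \<Longrightarrow> h t = m * t + b"
  shows "h l = m * l + b"
proof -
  have "((\<lambda>t. m * t + b) \<longlongrightarrow> m * l + b) (at_right l)" by (intro tendsto_intros)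
  moreover have "eventually (\<lambda>t. m * t + b = h t) (at_right l)"
    using eventually_at_right_real[OF assms(2)] by eventually_elim (simp add: assms(3))
  ultimately have "(h \<longlongrightarrow> m * l + b) (at_right l)" by (rule Lim_transform_eventually)
  moreover have "(h \<longlongrightarrow> h l) (at_right l)"
    using assms(1) by (simp add: continuous_within)
  ultimately show ?thesis using tendsto_unique trivial_limit_at_right_real by blast
qed

lemma thompson_V_I:
  assumes h: "h \<in> Bij {0..<1}" and tab: "dyadic_table K h"
  shows "h \<in> carrier thompson_V"
proof -
  have range: "h x \<in> {0..<1}" if "x \<in> {0..<1}" for x
    using Bij_imp_funcset[OF h] that by blast
  have "nondiff_points {0..<1} h \<subseteq> grid K"
    by (rule nondiff_points_subset_grid[OF tab]) auto
  then have nd: "finite (nondiff_points {0..<1} h)" "nondiff_points {0..<1} h \<subseteq> dyadics"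
    using finite_subset finite_grid grid_subset_dyadics by blast+
  have dy: "h ` (dyadics \<inter> {0..<1}) \<subseteq> dyadics"
  proof
    fix y assume "y \<in> h ` (dyadics \<inter> {0..<1})"
    then obtain x where x: "x \<in> dyadics \<inter> {0..<1}" "y = h x" by blast
    then have "0 \<le> h x" using range[of x] by simp
    then show "y \<in> dyadics" using dyadic_table_dyadics[OF tab x(1)] x(2) by simp
  qed
  \<comment> \<open>A piece to the right of x settles both right continuity at x and, where h is
    differentiable, the value of the derivative.\<close>
  have piece: "\<exists>r (i::int) b. x < r \<and> {x..<r} \<subseteq> {0..<1} \<and> (\<forall>t\<in>{x..<r}. h t = 2 powi i * t + b)"
    if x: "x \<in> {0..<1}" for x
  proof -
    obtain a where a: "a < 2^K" "x \<in> {real a / 2^K..<(real a + 1) / 2^K}"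
      using unit_interval_grid_cases[OF x] .
    obtain i :: int and b where
      ib: "\<forall>t\<in>{real a / 2^K..<(real a + 1) / 2^K}. h t = 2 powi i * t + b"
      using dyadic_table_affine[OF tab a(1)] by blast
    have "x < (real a + 1) / 2^K" using a(2) by simp
    moreover have "{x..<(real a + 1) / 2^K} \<subseteq> {0..<1}"
      using dyadic_point_in_unit_interval(2)[OF a(1)] x
      unfolding subset_iff atLeastLessThan_iff by linarith
    moreover have "\<forall>t\<in>{x..<(real a + 1) / 2^K}. h t = 2 powi i * t + b"
      using ib a(2) by (simp only: Ball_def atLeastLessThan_iff) (meson order_trans)
    ultimately show ?thesis by blast
  qed
  have rc: "continuous (at_right x) h" if x: "x \<in> {0..<1}" for x
  proof -
    obtain r i b where r: "x < r" "\<forall>t\<in>{x..<r}. h t = 2 powi (i::int) * t + b"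
      using piece[OF x] by blast
    have "((\<lambda>t. 2 powi i * t + b) \<longlongrightarrow> 2 powi i * x + b) (at_right x)" by (intro tendsto_intros)
    moreover have "eventually (\<lambda>t. 2 powi i * t + b = h t) (at_right x)"
      using eventually_at_right_real[OF r(1)] by eventually_elim (use r(2) in simp)
    ultimately have "(h \<longlongrightarrow> 2 powi i * x + b) (at_right x)" by (rule Lim_transform_eventually)
    moreover have "h x = 2 powi i * x + b" using r by simp
    ultimately show ?thesis by (simp add: continuous_within)
  qed
  have comp: "\<exists>(i::int) b. \<forall>x\<in>J. h x = 2 powi i * x + b"
    if J: "J \<in> components ({0..<1} - nondiff_points {0..<1} h)" for J
  proof (rule powi_derivative_affine)
    show "is_interval J"
      using in_components_connected[OF J] by (simp add: is_interval_connected_1)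
    fix x assume "x \<in> J"
    have J': "J \<subseteq> {0..<1} - nondiff_points {0..<1} h" using in_components_subset[OF J] .
    then have x: "x \<in> {0..<1}" "h differentiable (at x within {0..<1})"
      using \<open>x \<in> J\<close> by (auto simp: nondiff_points_def)
    obtain r i b where r: "x < r" "{x..<r} \<subseteq> {0..<1}" "\<forall>t\<in>{x..<r}. h t = 2 powi (i::int) * t + b"
      using piece[OF x(1)] by blast
    have "(h has_real_derivative 2 powi i) (at x within {0..<1})"
    proof (rule affine_piece_derivative[OF connected_Ico r(2) _ _ _ _ x(2)])
      show "x \<in> {x..<r}" "(x + r) / 2 \<in> {x..<r}" "(x + r) / 2 \<noteq> x" using r(1) by auto
    qed (use r(3) in blast)
    then show "\<exists>i::int. (h has_real_derivative 2 powi i) (at x within J)"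
      using DERIV_subset J' by blast
  qed
  show ?thesis using h rc dy nd comp by (simp add: thompson_V_def)
qed

lemma thompson_V_E:
  assumes h: "h \<in> carrier thompson_V"
  shows "h \<in> Bij {0..<1}" "\<exists>K. dyadic_table K h"
proof -
  define D where "D = nondiff_points {0..<1} h"
  show Bij: "h \<in> Bij {0..<1}" using h by (simp add: thompson_V_def)
  have rc: "\<And>x. x \<in> {0..<1} \<Longrightarrow> continuous (at_right x) h"
    and dy: "h ` (dyadics \<inter> {0..<1}) \<subseteq> dyadics"
    and D: "finite D" "D \<subseteq> dyadics" "D \<subseteq> {0..1}"
    and comp: "\<And>J. J \<in> components ({0..<1} - D) \<Longrightarrow> \<exists>(i::int) b. \<forall>x\<in>J. h x = 2 powi i * x + b"
    using h by (auto simp: thompson_V_def D_def nondiff_points_def)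
  obtain K where K: "D \<subseteq> grid K" using dyadics_finite_subset_grid[OF D] by blast
  show "\<exists>K. dyadic_table K h"
  proof (rule dyadic_table_of_affine)
    fix a :: nat assume a: "a < 2^K"
    let ?l = "real a / 2^K" and ?r = "(real a + 1) / 2^K"
    have lr: "0 \<le> ?l" "?r \<le> 1" "?l < ?r" using dyadic_point_in_unit_interval[OF a] .
    then have l: "?l \<in> {0..<1}" unfolding atLeastLessThan_iff by linarith
    have "{?l<..<?r} \<subseteq> {0..<1}"
      unfolding subset_iff greaterThanLessThan_iff atLeastLessThan_iff using lr by linarith
    then have sub: "{?l<..<?r} \<subseteq> {0..<1} - D" using grid_open_interval[OF a] K by blast
    have ne: "{?l<..<?r} \<noteq> {}" using lr(3) by simp
    \<comment> \<open>The condition in V speaks of whole components; the open row is connected and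
      avoids \<open>D\<close>, so it lies in one of them.\<close>
    obtain J where "J \<in> components ({0..<1} - D)" "{?l<..<?r} \<subseteq> J"
      using exists_component_superset[OF sub _ connected_Ioo] ne sub by blast
    then obtain i :: int and b where ib: "\<And>x. x \<in> {?l<..<?r} \<Longrightarrow> h x = 2 powi i * x + b"
      using comp by blast
    have "h ?l = 2 powi i * ?l + b" by (rule right_continuous_affine[OF rc[OF l] lr(3) ib])
    then have "h x = 2 powi i * x + b" if "x \<in> {?l..<?r}" for x
      using ib[of x] that by (cases "x = ?l") auto
    then show "\<exists>(i::int) b. \<forall>x\<in>{?l..<?r}. h x = 2 powi i * x + b" by blast
    have "?l \<in> dyadics" using grid_subset_dyadics grid_endpoints(1)[OF a] by blast
    then have "h ?l \<in> dyadics" using dy l by blast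
    then obtain m k where "h ?l = real m / 2^k" unfolding dyadics_def by blast
    then have "h ?l = of_int (int m) / 2^k" by simp
    then show "\<exists>(z::int) n. h ?l = of_int z / 2^n" by blast
  qed
qed

lemma thompson_V_inverse:
  assumes h: "h \<in> carrier thompson_V"
  shows "restrict (inv_into {0..<1} h) {0..<1} \<in> carrier thompson_V"
proof -
  obtain K where K: "dyadic_table K h" using thompson_V_E(2)[OF h] by blast
  have bij: "bij_betw h {0..<1} {0..<1}" using thompson_V_E(1)[OF h] by (simp add: Bij_def)
  have "\<exists>L. dyadic_table L (restrict (inv_into {0..<1} h) {0..<1})"
  proof (rule dyadic_table_inverse[OF K])
    show "{0..<1} \<subseteq> h ` {0..<1}" using bij by (simp add: bij_betw_def)
    fix x :: real assume x: "x \<in> {0..<1}"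
    then have "h x \<in> {0..<1}" using bij bij_betwE by blast
    then show "restrict (inv_into {0..<1} h) {0..<1} (h x) = x"
      using bij x by (simp add: bij_betw_def)
  qed
  then show ?thesis using thompson_V_I restrict_inv_into_Bij thompson_V_E(1)[OF h] by blast
qed


section \<open>Thompson's group T\<close>

text \<open>Near an integer, points to the right go close to 0 and points to the left close to 1,
  the two points that the quotient identifies. Elsewhere \<open>frac\<close> is locally a
  translation.\<close>

lemma continuous_map_frac_circle: "continuous_map euclideanreal circle frac"
  unfolding continuous_map_def
proof (intro conjI allI impI)
  show "frac \<in> topspace euclideanreal \<rightarrow> topspace circle"
    by (auto simp: topspace_circle frac_lt_1)
  fix U assume "openin circle U"
  then have "openin (top_of_set {0..1}) {x \<in> {0..1}. frac x \<in> U}"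
    by (simp add: circle_def openin_quotient_topology)
  then obtain W where W: "open W" "{x \<in> {0..1}. frac x \<in> U} = {0..1} \<inter> W"
    by (auto simp: openin_open)
  then have WU: "t \<in> W \<longleftrightarrow> frac t \<in> U" if "t \<in> {0..1}" for t using that by blast
  have "open {x. frac x \<in> U}"
  proof (subst open_subopen, intro ballI)
    fix x assume x: "x \<in> {x. frac x \<in> U}"
    define n :: real where "n = of_int \<lfloor>x\<rfloor>"
    have xn: "x = n + frac x" by (simp add: n_def frac_def)
    have shift: "frac (y - n) = frac y" "frac (y - n + 1) = frac y" for y
      using frac_add_of_int_right[of y "- \<lfloor>x\<rfloor>"] frac_add_of_int_right[of y "1 - \<lfloor>x\<rfloor>"]
      by (simp_all add: n_def algebra_simps)
    have frac01: "frac x \<in> {0..<1}" by (simp add: frac_lt_1)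
    show "\<exists>T. open T \<and> x \<in> T \<and> T \<subseteq> {x. frac x \<in> U}"
    proof (cases "frac x = 0")
      case False
      let ?T = "(\<lambda>t. t - n) -` (W \<inter> {0<..<1})"
      have "open ?T" using W(1) by (intro open_vimage continuous_intros open_Int) auto
      moreover have "x \<in> ?T"
      proof -
        have "x - n = frac x" using xn by linarith
        moreover have "frac x \<in> W" using x frac01 WU[of "frac x"] by simp
        moreover have "frac x \<in> {0<..<1}" using False frac01 by (simp add: less_le)
        ultimately show ?thesis by simp
      qed
      moreover have "?T \<subseteq> {x. frac x \<in> U}"
      proof
        fix y assume "y \<in> ?T"
        then show "y \<in> {x. frac x \<in> U}" using WU[of "y - n"] shift(1)[of y] by simp
      qed
      ultimately show ?thesis by blast
    next
      case True
      \<comment> \<open>The first preimage serves y \<ge> n, the second y < n, where y - n + 1 is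
        close to 1.\<close>
      let ?T = "(\<lambda>t. t - n) -` (W \<inter> {-1<..<1}) \<inter> (\<lambda>t. t - n + 1) -` W"
      have "0 \<in> U" using x True by simp
      then have "0 \<in> W" "1 \<in> W" using WU[of 0] WU[of 1] by (simp_all add: frac_def)
      have "open ?T" using W(1) by (intro open_vimage continuous_intros open_Int) auto
      moreover have "x \<in> ?T" using xn True \<open>0 \<in> W\<close> \<open>1 \<in> W\<close> by simp
      moreover have "?T \<subseteq> {x. frac x \<in> U}"
      proof
        fix y assume y: "y \<in> ?T"
        show "y \<in> {x. frac x \<in> U}"
        proof (cases "n \<le> y")
          case True
          then show ?thesis using y WU[of "y - n"] shift(1)[of y] by simp
        next
          case False
          then show ?thesis using y WU[of "y - n + 1"] shift(2)[of y] by simp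
        qed
      qed
      ultimately show ?thesis by blast
    qed
  qed
  then show "openin euclideanreal {x \<in> topspace euclideanreal. frac x \<in> U}" by simp
qed

lemma circle_lift_continuous_map:
  assumes "circle_lift h H"
  shows "continuous_map circle circle h"
proof -
  have "continuous_map (top_of_set {0..1}) euclideanreal H"
    using assms continuous_on_subset by (auto simp: circle_lift_def)
  then have "continuous_map (top_of_set {0..1}) circle (frac \<circ> H)"
    using continuous_map_frac_circle by (rule continuous_map_compose)
  moreover have "frac \<circ> H = h \<circ> frac" using assms by (auto simp: circle_lift_def)
  ultimately have "continuous_map (top_of_set {0..1}) circle (h \<circ> frac)" by simp
  then show ?thesis
    using quotient_map_quotient_topology continuous_compose_quotient_map
    unfolding circle_def by blast
qed

section \<open>Lifts of circle maps to the line\<close>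

lemma periodic_shift_of_int:
  fixes H :: "real \<Rightarrow> real"
  assumes "\<And>x. H (x + 1) = H x + 1"
  shows "H (x + of_int n) = H x + of_int n"
proof (induction n rule: int_induct[where k = 0])
  case (step1 i)
  then show ?case using assms[of "x + of_int i"] by (simp add: add.assoc)
next
  case (step2 i)
  then show ?case using assms[of "x + of_int (i - 1)"] by simp
qed simp

text \<open>Periodicity makes the range unbounded in both directions, and the intermediate value
  theorem fills it. The inverse is continuous because a monotone map with full range has no
  jumps.\<close>

lemma lift_inverse:
  fixes H :: "real \<Rightarrow> real"
  assumes cont: "continuous_on UNIV H" and mono: "strict_mono H" and per: "\<And>x. H (x + 1) = H x + 1"
  obtains H' where "continuous_on UNIV H'" "strict_mono H'" "\<And>x. H' (x + 1) = H' x + 1"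
    "\<And>x. H (H' x) = x" "\<And>x. H' (H x) = x"
proof -
  have "\<exists>x. H x = y" for y
  proof -
    define n where "n = \<lfloor>y - H 0\<rfloor>"
    have "H (of_int n) = H 0 + of_int n" "H (of_int n + 1) = H 0 + of_int n + 1"
      using periodic_shift_of_int[where H = H, OF per, of 0 n] per[of "of_int n"] by simp_all
    moreover have "of_int n \<le> y - H 0" "y - H 0 \<le> of_int n + 1" unfolding n_def by linarith+
    ultimately have "H (of_int n) \<le> y" "y \<le> H (of_int n + 1)" by linarith+
    then show ?thesis
      using IVT'[of H "of_int n" y "of_int n + 1"] continuous_on_subset[OF cont] by auto
  qed
  then obtain H' where HH': "\<And>y. H (H' y) = y" by metis
  have inj: "inj H" using mono by (rule strict_mono_imp_inj_on)
  then have H'H: "H' (H x) = x" for x using HH'[of "H x"] by (auto dest: injD)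
  have mono': "strict_mono H'"
  proof (rule strict_monoI)
    fix x y :: real assume "x < y"
    then show "H' x < H' y" using strict_mono_less[OF mono, of "H' x" "H' y"] HH' by simp
  qed
  have "range H' = UNIV" using H'H by (metis surjI)
  then have "continuous_on UNIV H'"
    using strict_mono_less_eq[OF mono'] by (intro continuous_onI_mono) auto
  moreover have "H' (x + 1) = H' x + 1" for x
    using H'H[of "H' x + 1"] per[of "H' x"] HH'[of x] by simp
  ultimately show ?thesis using that mono' HH' H'H by blast
qed

text \<open>Distinct integers are at distance at least 1. Applied below to the difference of two
  functions that agree modulo 1.\<close>

lemma integer_valued_constant:
  fixes f :: "real \<Rightarrow> real"
  assumes "connected S" "continuous_on S f" "\<And>x. x \<in> S \<Longrightarrow> f x \<in> \<int>" "S \<noteq> {}"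
  shows "\<exists>n::int. \<forall>x\<in>S. f x = of_int n"
proof -
  have "f constant_on S"
  proof (rule continuous_discrete_range_constant[OF assms(1,2)])
    fix x assume x: "x \<in> S"
    have "1 \<le> norm (f y - f x)" if y: "y \<in> S" "f y \<noteq> f x" for y
    proof -
      have "f y - f x \<in> \<int>" using assms(3) x y by (intro Ints_diff)
      then show ?thesis using y(2) Ints_nonzero_abs_ge1[of "f y - f x"] by simp
    qed
    then show "\<exists>e>0. \<forall>y. y \<in> S \<and> f y \<noteq> f x \<longrightarrow> e \<le> norm (f y - f x)"
      by (intro exI[of _ 1]) auto
  qed
  then obtain c where c: "\<And>x. x \<in> S \<Longrightarrow> f x = c" by (auto simp: constant_on_def)
  moreover obtain x where "x \<in> S" using assms(4) by blast
  ultimately have "c \<in> \<int>" using assms(3) by metis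
  then show ?thesis using c by (metis Ints_cases)
qed

text \<open>On one row, \<open>H\<close> and the affine formula for h agree modulo 1. By
  connectedness they differ by one integer n, which shifts the index c by \<open>n * 2^l\<close>;
  hence a table must admit arbitrary integer indices.\<close>

lemma dyadic_table_lift:
  assumes tab: "dyadic_table K h" and cont: "continuous_on UNIV H"
    and lift: "\<And>x. x \<in> {0..<1} \<Longrightarrow> frac (H x) = h x"
  shows "dyadic_table K H"
  unfolding dyadic_table_def
proof (intro allI impI)
  fix a :: nat assume a: "a < 2^K"
  then obtain c :: int and l where cl:
    "\<And>u. u \<in> {0..<1} \<Longrightarrow> h ((real a + u) / 2^K) = (of_int c + u) / 2^l"
    using tab unfolding dyadic_table_def by blast
  let ?f = "\<lambda>u. H ((real a + u) / 2^K) - (of_int c + u) / 2^l"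
  have "\<exists>n::int. \<forall>u\<in>{0..<1}. ?f u = of_int n"
  proof (rule integer_valued_constant[OF connected_Ico])
    have "continuous_on {0..<1} (\<lambda>u. H ((real a + u) / 2^K))"
      by (rule continuous_on_compose2[OF cont]) (auto intro!: continuous_intros)
    then show "continuous_on {0..<1} ?f" by (intro continuous_intros) auto
    fix u :: real assume u: "u \<in> {0..<1}"
    have "(real a + u) / 2^K \<in> {0..<1}" using dyadic_fraction_bounds[OF a, of u] u by simp
    then have "?f u = H ((real a + u) / 2^K) - frac (H ((real a + u) / 2^K))"
      using lift cl[OF u] by simp
    then show "?f u \<in> \<int>" by (simp add: frac_def)
  qed simp
  then obtain n :: int where n: "\<And>u. u \<in> {0..<1} \<Longrightarrow> ?f u = of_int n" by blast
  have "H ((real a + u) / 2^K) = (of_int (c + n * 2^l) + u) / 2^l" if "u \<in> {0..<1}" for u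
    using n[OF that] by (simp add: field_simps)
  then show "\<exists>(c::int) l. \<forall>u\<in>{0..<1}. H ((real a + u) / 2^K) = (of_int c + u) / 2^l" by blast
qed

text \<open>A standard interval lies between consecutive integers, so \<open>frac\<close> acts on it
  as one translation and reduces the index modulo 2^l.\<close>

lemma dyadic_table_frac:
  assumes tab: "dyadic_table K H" and lift: "\<And>x. x \<in> {0..<1} \<Longrightarrow> h x = frac (H x)"
  shows "dyadic_table K h"
  unfolding dyadic_table_def
proof (intro allI impI)
  fix a :: nat assume a: "a < 2^K"
  then obtain c :: int and l where cl:
    "\<And>u. u \<in> {0..<1} \<Longrightarrow> H ((real a + u) / 2^K) = (of_int c + u) / 2^l"
    using tab unfolding dyadic_table_def by blast
  define d where "d = c mod 2^l"
  have d: "0 \<le> d" "nat d < 2^l" by (simp_all add: d_def nat_less_iff)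
  have c: "c = (c div 2^l) * 2^l + d" unfolding d_def by (rule div_mult_mod_eq[symmetric])
  have "h ((real a + u) / 2^K) = (of_int d + u) / 2^l" if u: "u \<in> {0..<1}" for u
  proof -
    have "(of_int c + u) / 2^l = of_int (c div 2^l) + (of_int d + u) / (2^l :: real)"
      by (subst c) (simp add: add_divide_distrib)
    moreover have "(of_int d + u) / 2^l \<in> {0..<1}"
      using dyadic_fraction_bounds[OF d(2), of u] u d(1) by simp
    ultimately have "frac ((of_int c + u) / 2^l) = (of_int d + u) / 2^l"
      by (simp only: frac_add_of_int_left) (simp add: frac_eq)
    then show ?thesis
      using lift[of "(real a + u) / 2^K"] dyadic_fraction_bounds[OF a, of u] u cl[OF u] by simp
  qed
  then show "\<exists>(c::int) l. \<forall>u\<in>{0..<1}. h ((real a + u) / 2^K) = (of_int c + u) / 2^l" by blast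
qed

lemma thompson_T_I:
  assumes ext: "h \<in> extensional {0..<1}" and lift: "circle_lift h H"
    and mono: "strict_mono H" and per: "\<And>x. H (x + 1) = H x + 1" and tab: "dyadic_table K h"
  shows "h \<in> carrier thompson_T"
proof -
  have cont: "continuous_on UNIV H" and frac_H: "\<And>x. frac (H x) = h (frac x)"
    using lift by (auto simp: circle_lift_def)
  have h_unit: "h x = frac (H x)" if "x \<in> {0..<1}" for x
    using frac_H[of x] that by (simp add: frac_eq)
  have tabH: "dyadic_table K H" by (rule dyadic_table_lift[OF tab cont]) (simp add: h_unit)
  obtain H' where H': "continuous_on UNIV H'" "strict_mono H'" "\<And>x. H' (x + 1) = H' x + 1"
    "\<And>x. H (H' x) = x" "\<And>x. H' (H x) = x"
    using lift_inverse[OF cont mono per] by blast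
  have frac_H': "frac (H' x) = frac (H' (frac x))" for x
    using periodic_shift_of_int[where H = H', OF H'(3), of "frac x" "\<lfloor>x\<rfloor>"] by (simp add: frac_def)
  have "homeomorphic_maps circle circle h (\<lambda>x. frac (H' x))"
    unfolding homeomorphic_maps_def
  proof (intro conjI ballI)
    show "continuous_map circle circle h" by (rule circle_lift_continuous_map[OF lift])
    show "continuous_map circle circle (\<lambda>x. frac (H' x))"
      by (rule circle_lift_continuous_map[of _ H']) (use H'(1) frac_H' in \<open>simp add: circle_lift_def\<close>)
    fix x assume "x \<in> topspace circle"
    then have x: "x \<in> {0..<1}" by (simp add: topspace_circle)
    then show "frac (H' (h x)) = x"
      using h_unit[OF x] frac_H'[of "H x"] H'(5)[of x] by (simp add: frac_eq)
    show "h (frac (H' x)) = x" using frac_H[of "H' x"] H'(4)[of x] x by (simp add: frac_eq)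
  qed
  then have hom: "homeomorphic_map circle circle h" by (rule homeomorphic_maps_imp_map)
  have dy: "h ` (dyadics \<inter> {0..<1}) \<subseteq> dyadics"
    using dyadic_table_dyadics[OF tab] h_unit by fastforce
  have "nondiff_points UNIV H \<inter> {0..<1} \<subseteq> grid K"
  proof
    fix x assume "x \<in> nondiff_points UNIV H \<inter> {0..<1}"
    then have "x \<in> {0..1}" "\<not> H differentiable (at x)" by (auto simp: nondiff_points_def)
    then show "x \<in> grid K" using dyadic_table_differentiable[OF tabH] by blast
  qed
  then have nd: "finite (nondiff_points UNIV H \<inter> {0..<1})" "nondiff_points UNIV H \<inter> {0..<1} \<subseteq> dyadics"
    using finite_subset finite_grid grid_subset_dyadics by blast+
  have deriv: "\<exists>i::int. (H has_real_derivative 2 powi i) (at x)" if "x \<notin> nondiff_points UNIV H" for x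
  proof -
    have diff: "H differentiable (at x)" using that by (simp add: nondiff_points_def)
    have "frac x \<in> {0..<1}" by (simp add: frac_lt_1)
    then obtain a where a: "a < 2^K" "frac x \<in> {real a / 2^K..<(real a + 1) / 2^K}"
      by (rule unit_interval_grid_cases)
    obtain i :: int and b where
      ib: "\<And>t. t \<in> {real a / 2^K..<(real a + 1) / 2^K} \<Longrightarrow> H t = 2 powi i * t + b"
      using dyadic_table_affine[OF tabH a(1)] by blast
    define n where "n = \<lfloor>x\<rfloor>"
    \<comment> \<open>The table describes \<open>H\<close> on [0,1) only; periodicity carries the
      row containing \<open>frac x\<close> to its translate by the integer part of x.\<close>
    define J where "J = {real a / 2^K + of_int n..<(real a + 1) / 2^K + of_int n}"
    have xn: "x = frac x + of_int n" by (simp add: n_def frac_def)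
    have "(H has_real_derivative 2 powi i) (at x)"
    proof (rule affine_piece_derivative[OF _ subset_UNIV _ _ _ _ diff])
      show "connected J" by (simp add: J_def)
      show "x \<in> J" using a(2) xn by (simp add: J_def)
      have "(x + r) / 2 \<in> {l..<r} \<and> (x + r) / 2 \<noteq> x" if "x \<in> {l..<r}" for l r
        using that by auto
      then show "(x + ((real a + 1) / 2^K + of_int n)) / 2 \<in> J"
        "(x + ((real a + 1) / 2^K + of_int n)) / 2 \<noteq> x"
        using \<open>x \<in> J\<close> unfolding J_def by blast+
      fix t assume "t \<in> J"
      then have "t - of_int n \<in> {real a / 2^K..<(real a + 1) / 2^K}"
        by (simp add: J_def le_diff_eq diff_less_eq)
      then show "H t = 2 powi i * t + (b - 2 powi i * of_int n + of_int n)"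
        using ib periodic_shift_of_int[where H = H, OF per, of "t - of_int n" n] by (simp add: algebra_simps)
    qed
    then show ?thesis by blast
  qed
  show ?thesis
    using ext hom dy lift mono per piecewise_linear_on_dyadic_table[OF tabH order_refl] nd deriv
    unfolding thompson_T_def by auto
qed

lemma thompson_T_E:
  assumes h: "h \<in> carrier thompson_T"
  obtains H K where "h \<in> extensional {0..<1}" "bij_betw h {0..<1} {0..<1}"
    "circle_lift h H" "strict_mono H" "\<And>x. H (x + 1) = H x + 1" "dyadic_table K h"
proof -
  obtain H where ext: "h \<in> extensional {0..<1}" and hom: "homeomorphic_map circle circle h"
    and dy: "h ` (dyadics \<inter> {0..<1}) \<subseteq> dyadics"
    and lift: "circle_lift h H" and mono: "strict_mono H" and per: "\<And>x. H (x + 1) = H x + 1"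
    and nd: "finite (nondiff_points UNIV H \<inter> {0..<1})" "nondiff_points UNIV H \<inter> {0..<1} \<subseteq> dyadics"
    and deriv: "\<And>x. x \<notin> nondiff_points UNIV H \<Longrightarrow> \<exists>i::int. (H has_real_derivative 2 powi i) (at x)"
    using h unfolding thompson_T_def by auto
  have bij: "bij_betw h {0..<1} {0..<1}"
    using homeomorphic_imp_surjective_map[OF hom] homeomorphic_imp_injective_map[OF hom]
    by (simp add: bij_betw_def topspace_circle)
  have cont: "continuous_on UNIV H" and frac_H: "\<And>x. frac (H x) = h (frac x)"
    using lift by (auto simp: circle_lift_def)
  have h_unit: "h x = frac (H x)" if "x \<in> {0..<1}" for x
    using frac_H[of x] that by (simp add: frac_eq)
  define D where "D = nondiff_points UNIV H \<inter> {0..<1}"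
  have "D \<subseteq> {0..1}" by (auto simp: D_def)
  then obtain K where K: "D \<subseteq> grid K" using dyadics_finite_subset_grid nd unfolding D_def by blast
  \<comment> \<open>The table is built for \<open>H\<close> first: h may jump on [0,1), but
    \<open>H\<close> is continuous, so dyadic values propagate along the grid from
    \<open>H 0\<close>, which is an integer plus \<open>h 0\<close>.\<close>
  have "\<exists>L. dyadic_table L H"
  proof (rule dyadic_table_of_closed_affine)
    fix a :: nat assume a: "a < 2^K"
    let ?l = "real a / 2^K" and ?r = "(real a + 1) / 2^K"
    have lr: "0 \<le> ?l" "?r \<le> 1" "?l < ?r" using dyadic_point_in_unit_interval[OF a] .
    have sub: "{?l<..<?r} \<subseteq> {0..<1}"
      unfolding subset_iff greaterThanLessThan_iff atLeastLessThan_iff using lr by linarith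
    have "\<exists>i::int. (H has_real_derivative 2 powi i) (at x within {?l<..<?r})" if x: "x \<in> {?l<..<?r}" for x
    proof -
      have "x \<notin> nondiff_points UNIV H"
        using x sub K grid_open_interval[OF a x] unfolding D_def by blast
      then show ?thesis using deriv has_field_derivative_at_within by blast
    qed
    then obtain i :: int and b where ib: "\<forall>x\<in>{?l<..<?r}. H x = 2 powi i * x + b"
      using powi_derivative_affine[of "{?l<..<?r}" H] is_interval_oo by blast
    have "H x = 2 powi i * x + b" if "x \<in> {?l..?r}" for x
      by (rule affine_closure[OF continuous_on_subset[OF cont] lr(3) _ that]) (use ib in auto)
    then show "\<exists>(i::int) b. \<forall>x\<in>{?l..?r}. H x = 2 powi i * x + b" by blast
  next
    have "(0::real) \<in> dyadics" using real_in_dyadics[of 0] by simp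
    then have "h 0 \<in> dyadics" using dy by auto
    then obtain m k where "h 0 = real m / 2^k" unfolding dyadics_def by blast
    then have "H 0 = of_int \<lfloor>H 0\<rfloor> + real m / 2^k" using h_unit[of 0] by (simp add: frac_def)
    also have "\<dots> = of_int (\<lfloor>H 0\<rfloor> * 2^k + int m) / 2^k" by (simp add: field_simps)
    finally show "\<exists>(z::int) n. H 0 = of_int z / 2^n" by blast
  qed
  then obtain L where "dyadic_table L H" by blast
  then have "dyadic_table L h" using h_unit by (rule dyadic_table_frac)
  then show ?thesis using that ext bij lift mono per by blast
qed

lemma thompson_T_inverse:
  assumes h: "h \<in> carrier thompson_T"
  shows "restrict (inv_into {0..<1} h) {0..<1} \<in> carrier thompson_T"
proof -
  let ?g = "restrict (inv_into {0..<1} h) {0..<1}"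
  obtain H K where bij: "bij_betw h {0..<1} {0..<1}" and lift: "circle_lift h H"
    and mono: "strict_mono H" and per: "\<And>x. H (x + 1) = H x + 1" and tab: "dyadic_table K h"
    using thompson_T_E[OF h] by blast
  have cont: "continuous_on UNIV H" and frac_H: "\<And>x. frac (H x) = h (frac x)"
    using lift by (auto simp: circle_lift_def)
  obtain H' where H': "continuous_on UNIV H'" "strict_mono H'" "\<And>x. H' (x + 1) = H' x + 1"
    "\<And>x. H (H' x) = x" "\<And>x. H' (H x) = x"
    using lift_inverse[OF cont mono per] by blast
  have g_h: "?g (h x) = x" if x: "x \<in> {0..<1}" for x
  proof -
    have "h x \<in> {0..<1}" using bij x bij_betwE by blast
    then show ?thesis using bij x by (simp add: bij_betw_def)
  qed
  have "?g (frac x) = frac (H' x)" for x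
  proof -
    have "frac (H' x) \<in> {0..<1}" by (simp add: frac_lt_1)
    then have "?g (h (frac (H' x))) = frac (H' x)" by (rule g_h)
    then show ?thesis using frac_H[of "H' x"] H'(4)[of x] by simp
  qed
  then have lift': "circle_lift ?g H'" using H'(1) by (simp only: circle_lift_def) simp
  obtain L where "dyadic_table L ?g"
    using dyadic_table_inverse[OF tab, of ?g] bij g_h by (auto simp: bij_betw_def)
  then show ?thesis by (intro thompson_T_I[OF _ lift' H'(2,3)]) auto
qed


section \<open>Infinitely many ends\<close>

text \<open>Applied with \<open>c = 1\<close> to homeomorphisms of [0,1] and with
  \<open>c = 1/2\<close> to \<open>shrink_half\<close>.\<close>

lemma strict_mono_image_Icc:
  fixes h :: "real \<Rightarrow> real"
  assumes cont: "continuous_on {0..c} h" and mono: "strict_mono_on {0..c} h"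
    and ends: "h 0 = 0" "h c = c" "0 \<le> c"
  shows "h ` {0..c} = {0..c}" "h ` {0..<c} = {0..<c}"
proof -
  have bounds: "h x \<in> {0..c}" if "x \<in> {0..c}" for x
    using mono_onD[OF strict_mono_on_imp_mono_on[OF mono], of 0 x]
      mono_onD[OF strict_mono_on_imp_mono_on[OF mono], of x c] that ends by simp
  show img: "h ` {0..c} = {0..c}"
  proof
    show "{0..c} \<subseteq> h ` {0..c}"
    proof
      fix y assume "y \<in> {0..c}"
      then obtain x where "0 \<le> x" "x \<le> c" "h x = y"
        using IVT'[of h 0 y c] cont ends by auto
      then show "y \<in> h ` {0..c}" by auto
    qed
  qed (use bounds in blast)
  have "h ` ({0..c} - {c}) = h ` {0..c} - h ` {c}"
    using strict_mono_on_imp_inj_on[OF mono] ends(3) by (intro inj_on_image_set_diff) auto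
  moreover have "{0..c} - {c} = {0..<c}" by auto
  ultimately show "h ` {0..<c} = {0..<c}" using img ends(2) by simp
qed

section \<open>Increasing homeomorphisms of [0,1] as elements of F, T and V\<close>

context
  fixes h :: "real \<Rightarrow> real" and K :: nat
  assumes cont: "continuous_on {0..1} h" and mono: "strict_mono_on {0..1} h"
    and ends: "h 0 = 0" "h 1 = 1" and tab: "dyadic_table K h"
begin

lemma restrict_mem_thompson_F: "restrict h {0..1} \<in> carrier thompson_F"
proof (rule thompson_F_I)
  have "homeomorphic_map (top_of_set {0..1}) (top_of_set {0..1}) h"
    using cont strict_mono_image_Icc(1)[OF cont mono ends] strict_mono_on_imp_inj_on[OF mono]
    by (intro continuous_imp_homeomorphic_map)
      (auto simp: compact_space_subtopology Hausdorff_space_subtopology)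
  then show "homeomorphic_map (top_of_set {0..1}) (top_of_set {0..1}) (restrict h {0..1})"
    by (rule homeomorphic_map_eq) simp
  show "dyadic_table K (restrict h {0..1})" by (rule dyadic_table_cong[OF tab]) simp
qed simp

lemma bij_betw_unit: "bij_betw h {0..<1} {0..<1}"
  using strict_mono_image_Icc(2)[OF cont mono ends] strict_mono_on_imp_inj_on[OF mono]
  unfolding bij_betw_def by (auto intro: inj_on_subset)

lemma restrict_mem_thompson_V: "restrict h {0..<1} \<in> carrier thompson_V"
proof (rule thompson_V_I)
  show "restrict h {0..<1} \<in> Bij {0..<1}"
    using bij_betw_unit bij_betw_cong[of "{0..<1}" "restrict h {0..<1}" h "{0..<1}"]
    by (simp add: Bij_def del: restrict_apply)
  show "dyadic_table K (restrict h {0..<1})" by (rule dyadic_table_cong[OF tab]) simp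
qed

lemma restrict_mem_thompson_T: "restrict h {0..<1} \<in> carrier thompson_T"
proof (rule thompson_T_I)
  \<comment> \<open>Translated copies of h on the unit intervals. \<open>H\<close> is strictly
    increasing and onto, which yields continuity without a separate check at the integers.\<close>
  define H where "H x = of_int \<lfloor>x\<rfloor> + h (frac x)" for x
  have h01: "h x \<in> {0..<1}" if "x \<in> {0..<1}" for x using bij_betw_unit that bij_betwE by blast
  then have hfrac: "h (frac x) \<in> {0..<1}" for x by (simp add: frac_lt_1)
  show mono_H: "strict_mono H"
  proof (rule strict_monoI)
    fix x y :: real assume xy: "x < y"
    show "H x < H y"
    proof (cases "\<lfloor>x\<rfloor> = \<lfloor>y\<rfloor>")
      case True
      then have "frac x < frac y" using xy by (simp add: frac_def)
      then have "h (frac x) < h (frac y)"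
        by (intro strict_mono_onD[OF mono]) (auto intro: less_imp_le[OF frac_lt_1])
      then show ?thesis using True by (simp add: H_def)
    next
      case False
      then have "\<lfloor>x\<rfloor> + 1 \<le> \<lfloor>y\<rfloor>" using floor_mono[of x y] xy by linarith
      then have "real_of_int \<lfloor>x\<rfloor> + 1 \<le> of_int \<lfloor>y\<rfloor>" by (simp flip: of_int_le_iff)
      moreover have "h (frac x) < 1" "0 \<le> h (frac y)" using hfrac[of x] hfrac[of y] by auto
      ultimately show ?thesis by (simp add: H_def)
    qed
  qed
  have "y \<in> range H" for y
  proof -
    have "frac y \<in> h ` {0..<1}" using bij_betw_unit by (simp add: bij_betw_def frac_lt_1)
    then obtain t where t: "t \<in> {0..<1}" "frac y = h t" by blast
    then have "\<lfloor>of_int \<lfloor>y\<rfloor> + t\<rfloor> = \<lfloor>y\<rfloor>" by (intro floor_unique) auto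
    then have "H (of_int \<lfloor>y\<rfloor> + t) = of_int \<lfloor>y\<rfloor> + h t" by (simp add: H_def frac_def)
    then have "H (of_int \<lfloor>y\<rfloor> + t) = y" using t(2) by (simp add: frac_def)
    then show ?thesis by (metis rangeI)
  qed
  then have "range H = UNIV" by blast
  then have "continuous_on UNIV H"
    using strict_mono_less_eq[OF mono_H] by (intro continuous_onI_mono) auto
  moreover have "frac (H x) = restrict h {0..<1} (frac x)" for x
    using hfrac[of x] by (simp add: H_def frac_lt_1 frac_eq)
  ultimately show "circle_lift (restrict h {0..<1}) H" by (simp only: circle_lift_def) simp
  show "H (x + 1) = H x + 1" for x by (simp add: H_def frac_1_eq)
  show "dyadic_table K (restrict h {0..<1})" by (rule dyadic_table_cong[OF tab]) simp
qed simp

end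

text \<open>On \<open>[0,1]\<close>, the element of \<open>F\<close> with slopes \<open>1/2, 1, 2\<close> and breaks \<open>1/2, 3/4\<close>, and its copy
  rescaled to \<open>[0,1/2]\<close>.\<close>

definition shrink :: "real \<Rightarrow> real" where
  "shrink t = max (t / 2) (max (t - 1/4) (2 * t - 1))"

definition shrink_half :: "real \<Rightarrow> real" where
  "shrink_half t = min t (max (t / 2) (max (t - 1/8) (2 * t - 1/2)))"

text \<open>The breaks lie on the grid of level 2, and the four rows go to [0,1/8), [1/8,1/4),
  [1/4,1/2) and [1/2,1). The map is one of the two standard generators of F.\<close>

lemma dyadic_table_shrink: "dyadic_table 2 shrink"
  unfolding dyadic_table_def
proof (intro allI impI)
  fix a :: nat assume "a < 2^2"
  then consider "a = 0" | "a = 1" | "a = 2" | "a = 3" by fastforce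
  then show "\<exists>(c::int) l. \<forall>u\<in>{0..<1}. shrink ((real a + u) / 2^2) = (of_int c + u) / 2^l"
  proof cases
    case 1 then show ?thesis by (intro exI[of _ 0] exI[of _ 3]) (auto simp: shrink_def max_def)
  next
    case 2 then show ?thesis by (intro exI[of _ 1] exI[of _ 3]) (auto simp: shrink_def max_def)
  next
    case 3 then show ?thesis by (intro exI[of _ 1] exI[of _ 2]) (auto simp: shrink_def max_def field_simps)
  next
    case 4 then show ?thesis by (intro exI[of _ 1] exI[of _ 1]) (auto simp: shrink_def max_def field_simps)
  qed
qed

text \<open>Level 3 because the breaks are 1/4, 3/8 and 1/2; the outer \<open>min\<close> keeps the
  rows from index 4 on in place.\<close>

lemma dyadic_table_shrink_half: "dyadic_table 3 shrink_half"
  unfolding dyadic_table_def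
proof (intro allI impI)
  fix a :: nat assume a: "a < 2^3"
  consider "a = 0" | "a = 1" | "a = 2" | "a = 3" | "4 \<le> a" by fastforce
  then show "\<exists>(c::int) l. \<forall>u\<in>{0..<1}. shrink_half ((real a + u) / 2^3) = (of_int c + u) / 2^l"
  proof cases
    case 1 then show ?thesis by (intro exI[of _ 0] exI[of _ 4]) (auto simp: shrink_half_def max_def)
  next
    case 2 then show ?thesis by (intro exI[of _ 1] exI[of _ 4]) (auto simp: shrink_half_def max_def)
  next
    case 3 then show ?thesis by (intro exI[of _ 1] exI[of _ 3]) (auto simp: shrink_half_def max_def field_simps)
  next
    case 4 then show ?thesis by (intro exI[of _ 1] exI[of _ 2]) (auto simp: shrink_half_def max_def min_def field_simps)
  next
    case 5
    then have "4 \<le> real a" by simp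
    then show ?thesis
      by (intro exI[of _ "int a"] exI[of _ 3]) (auto simp: shrink_half_def max_def min_def field_simps)
  qed
qed

text \<open>The formulas as \<open>max\<close> and \<open>min\<close> of increasing affine maps give
  continuity, and likewise monotonicity below, without gluing at the breaks.\<close>

lemma continuous_on_shrink: "continuous_on A shrink" "continuous_on A shrink_half"
  unfolding shrink_def shrink_half_def by (auto intro!: continuous_intros)

lemma strict_mono_shrink: "strict_mono_on A shrink" "strict_mono_on A shrink_half"
  by (auto simp: strict_mono_on_def shrink_def shrink_half_def max_def min_def)

lemma shrink_values:
  "shrink 0 = 0" "shrink 1 = 1" "shrink_half 0 = 0" "shrink_half (1/2) = 1/2" "shrink_half 1 = 1"
  by (simp_all add: shrink_def shrink_half_def)

lemma shrink_eq: "x \<in> {0..<1/2} \<Longrightarrow> shrink x = x / 2"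
  by (auto simp: shrink_def max_def)

lemma shrink_half_eq: "x \<in> {0..<1/4} \<Longrightarrow> shrink_half x = x / 2"
  by (auto simp: shrink_half_def max_def)

lemma shrink_half_image: "shrink_half ` {0..<1/2} = {0..<1/2}"
  by (rule strict_mono_image_Icc(2))
    (simp_all add: continuous_on_shrink strict_mono_shrink shrink_values)

lemma shrink_mem:
  "restrict shrink {0..1} \<in> carrier thompson_F" "restrict shrink_half {0..1} \<in> carrier thompson_F"
  "restrict shrink {0..<1} \<in> carrier thompson_T" "restrict shrink_half {0..<1} \<in> carrier thompson_T"
  "restrict shrink {0..<1} \<in> carrier thompson_V" "restrict shrink_half {0..<1} \<in> carrier thompson_V"
  using dyadic_table_shrink dyadic_table_shrink_half
  by (auto intro!: restrict_mem_thompson_F restrict_mem_thompson_T restrict_mem_thompson_V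
      continuous_on_shrink strict_mono_shrink shrink_values)

lemma restrict_shrink:
  assumes "{0..<1/2} \<subseteq> A"
  shows "x \<in> {0..<1/2} \<Longrightarrow> restrict shrink A x = x / 2"
    and "restrict shrink_half A ` {0..<1/2} = {0..<1/2}"
    and "x \<in> {0..<1/4} \<Longrightarrow> restrict shrink_half A x = x / 2"
proof -
  show "restrict shrink A x = x / 2" if "x \<in> {0..<1/2}"
    using subsetD[OF assms that] shrink_eq[OF that] by simp
  have "restrict shrink_half A ` {0..<1/2} = shrink_half ` {0..<1/2}"
    by (rule image_cong[OF refl]) (use assms in auto)
  then show "restrict shrink_half A ` {0..<1/2} = {0..<1/2}" by (simp only: shrink_half_image)
  show "restrict shrink_half A x = x / 2" if x: "x \<in> {0..<1/4}"
  proof -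
    have "x \<in> {0..<1/2}" using x by auto
    then show ?thesis using subsetD[OF assms] shrink_half_eq[OF x] by simp
  qed
qed

section \<open>The three pairs of groups\<close>

lemma BijGroup_carrier_update:
  "thompson_F = (BijGroup {0..1})\<lparr>carrier := carrier thompson_F\<rparr>"
  "thompson_T = (BijGroup {0..<1})\<lparr>carrier := carrier thompson_T\<rparr>"
  "thompson_V = (BijGroup {0..<1})\<lparr>carrier := carrier thompson_V\<rparr>"
  by (simp_all add: thompson_F_def thompson_T_def thompson_V_def)

lemma pair_ends_thompson_F:
  assumes "finite_generating_set thompson_F S"
  shows "pair_ends thompson_F (fixing_subgroup thompson_F {0..1/2}) S = \<infinity>"
proof -
  \<comment> \<open>Continuity supplies the endpoint 1/2 that the half-open interval of the locale
    omits.\<close>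
  have fix_iff: "(\<forall>x\<in>{0..1/2}. h x = x) \<longleftrightarrow> (\<forall>x\<in>{0..<1/2}. h x = x)"
    if h: "h \<in> carrier thompson_F" for h
  proof
    assume fix_h: "\<forall>x\<in>{0..<1/2}. h x = x"
    have "continuous_on {0..1/2} h" using continuous_on_subset[OF thompson_F_E(4)[OF h]] by simp
    then have "h x = 1 * x + 0" if "x \<in> {0..1/2}" for x
      by (rule affine_closure[OF _ _ _ that]) (use fix_h in auto)
    then show "\<forall>x\<in>{0..1/2}. h x = x" by simp
  qed auto
  interpret dyadic_bij_group "{0..1}" "{0..1/2}" "carrier thompson_F"
    "restrict shrink {0..1}" "restrict shrink_half {0..1}" S
  proof
    show "carrier thompson_F \<subseteq> Bij {0..1}" using thompson_F_E(1,5) by (auto simp: Bij_def)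
    show "\<exists>K. dyadic_table K h" if "h \<in> carrier thompson_F" for h using thompson_F_E(3)[OF that] .
    show "finite_generating_set ((BijGroup {0..1})\<lparr>carrier := carrier thompson_F\<rparr>) S"
      using assms by (simp flip: BijGroup_carrier_update(1))
    show "h ` {0..<1} = {0..<1}" if "h \<in> carrier thompson_F" for h
      using thompson_F_unit[OF that] by (simp add: bij_betw_def)
    have half: "{0..<1/2} \<subseteq> {0..1::real}" by auto
    show "restrict shrink {0..1} x = x / 2" if "x \<in> {0..<1/2}" for x
      by (rule restrict_shrink(1)[OF half that])
    show "restrict shrink_half {0..1} ` {0..<1/2} = {0..<1/2}" by (rule restrict_shrink(2)[OF half])
    show "restrict shrink_half {0..1} x = x / 2" if "x \<in> {0..<1/4}" for x
      by (rule restrict_shrink(3)[OF half that])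
    show "(\<forall>x\<in>{0..1/2}. h x = x) \<longleftrightarrow> (\<forall>x\<in>{0..<1/2}. h x = x)"
      if "h \<in> carrier thompson_F" for h by (rule fix_iff[OF that])
  qed (simp_all only: shrink_mem thompson_F_inverse order_refl, auto)
  show ?thesis using pair_ends_infinity by (simp add: G_def flip: BijGroup_carrier_update(1))
qed

lemma pair_ends_thompson_T:
  assumes "finite_generating_set thompson_T S"
  shows "pair_ends thompson_T (fixing_subgroup thompson_T (frac ` {0..1/2})) S = \<infinity>"
proof -
  have "frac ` {0..1/2} = (\<lambda>x. x) ` {0..1/2::real}" by (intro image_cong) (auto simp: frac_eq)
  then have frac_image: "frac ` {0..1/2} = {0..1/2::real}" by simp
  have fix_iff: "(\<forall>x\<in>{0..1/2}. h x = x) \<longleftrightarrow> (\<forall>x\<in>{0..<1/2}. h x = x)"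
    if h: "h \<in> carrier thompson_T" for h
  proof
    assume fix_h: "\<forall>x\<in>{0..<1/2}. h x = x"
    obtain H where "circle_lift h H" using thompson_T_E[OF h] by blast
    then have cont: "continuous_on UNIV H" and frac_H: "\<And>x. frac (H x) = h (frac x)"
      by (auto simp: circle_lift_def)
    \<comment> \<open>As h may jump as a function on [0,1), the endpoint 1/2 is reached through the
      lift: \<open>H\<close> minus the identity is integer-valued on [0,1/2), hence constant there,
      and continuity extends this to 1/2.\<close>
    have "\<exists>n::int. \<forall>x\<in>{0..<1/2}. H x - x = of_int n"
    proof (rule integer_valued_constant[OF connected_Ico])
      show "continuous_on {0..<1/2} (\<lambda>x. H x - x)"
        by (intro continuous_intros continuous_on_subset[OF cont]) auto
      fix x :: real assume x: "x \<in> {0..<1/2}"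
      then have "frac (H x) = x" using frac_H[of x] fix_h by (simp add: frac_eq)
      then have "H x - x = of_int \<lfloor>H x\<rfloor>" by (simp add: frac_def)
      then show "H x - x \<in> \<int>" by simp
    qed simp
    then obtain n :: int where n: "\<And>x. x \<in> {0..<1/2} \<Longrightarrow> H x - x = of_int n" by blast
    have "H (1/2) = 1 * (1/2) + of_int n"
    proof (rule affine_closure[OF continuous_on_subset[OF cont]])
      show "H t = 1 * t + of_int n" if "t \<in> {0<..<1/2}" for t using n[of t] that by simp
    qed auto
    then have "h (1/2) = 1/2" using frac_H[of "1/2"] by (simp add: frac_eq)
    moreover have "x \<in> {0..<1/2} \<or> x = 1/2" if "x \<in> {0..1/2}" for x :: real
      using that by auto
    ultimately show "\<forall>x\<in>{0..1/2}. h x = x" using fix_h by metis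
  qed auto
  interpret dyadic_bij_group "{0..<1}" "{0..1/2}" "carrier thompson_T"
    "restrict shrink {0..<1}" "restrict shrink_half {0..<1}" S
  proof
    show "carrier thompson_T \<subseteq> Bij {0..<1}" by (auto simp: Bij_def elim: thompson_T_E)
    show "\<exists>K. dyadic_table K h" if "h \<in> carrier thompson_T" for h using thompson_T_E[OF that] by blast
    show "finite_generating_set ((BijGroup {0..<1})\<lparr>carrier := carrier thompson_T\<rparr>) S"
      using assms by (simp flip: BijGroup_carrier_update(2))
    show "h ` {0..<1} = {0..<1}" if "h \<in> carrier thompson_T" for h
      using thompson_T_E[OF that] by (metis bij_betw_def)
    have half: "{0..<1/2} \<subseteq> {0..<1::real}" by auto
    show "restrict shrink {0..<1} x = x / 2" if "x \<in> {0..<1/2}" for x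
      by (rule restrict_shrink(1)[OF half that])
    show "restrict shrink_half {0..<1} ` {0..<1/2} = {0..<1/2}" by (rule restrict_shrink(2)[OF half])
    show "restrict shrink_half {0..<1} x = x / 2" if "x \<in> {0..<1/4}" for x
      by (rule restrict_shrink(3)[OF half that])
    show "(\<forall>x\<in>{0..1/2}. h x = x) \<longleftrightarrow> (\<forall>x\<in>{0..<1/2}. h x = x)"
      if "h \<in> carrier thompson_T" for h by (rule fix_iff[OF that])
  qed (simp_all only: shrink_mem thompson_T_inverse order_refl)
  show ?thesis
    using pair_ends_infinity by (simp add: frac_image G_def flip: BijGroup_carrier_update(2))
qed

lemma pair_ends_thompson_V:
  assumes "finite_generating_set thompson_V S"
  shows "pair_ends thompson_V (fixing_subgroup thompson_V {0..<1/2}) S = \<infinity>"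
proof -
  interpret dyadic_bij_group "{0..<1}" "{0..<1/2}" "carrier thompson_V"
    "restrict shrink {0..<1}" "restrict shrink_half {0..<1}" S
  proof
    show "carrier thompson_V \<subseteq> Bij {0..<1}" using thompson_V_E(1) by blast
    show "\<exists>K. dyadic_table K h" if "h \<in> carrier thompson_V" for h using thompson_V_E(2)[OF that] .
    show "finite_generating_set ((BijGroup {0..<1})\<lparr>carrier := carrier thompson_V\<rparr>) S"
      using assms by (simp flip: BijGroup_carrier_update(3))
    show "h ` {0..<1} = {0..<1}" if "h \<in> carrier thompson_V" for h
      using thompson_V_E(1)[OF that] by (simp add: Bij_def bij_betw_def)
    have half: "{0..<1/2} \<subseteq> {0..<1::real}" by auto
    show "restrict shrink {0..<1} x = x / 2" if "x \<in> {0..<1/2}" for x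
      by (rule restrict_shrink(1)[OF half that])
    show "restrict shrink_half {0..<1} ` {0..<1/2} = {0..<1/2}" by (rule restrict_shrink(2)[OF half])
    show "restrict shrink_half {0..<1} x = x / 2" if "x \<in> {0..<1/4}" for x
      by (rule restrict_shrink(3)[OF half that])
  qed (simp_all only: shrink_mem thompson_V_inverse order_refl)
  show ?thesis using pair_ends_infinity by (simp add: G_def flip: BijGroup_carrier_update(3))
qed

theorem theorem1p1:
  shows "(\<forall>S. finite_generating_set thompson_F S \<longrightarrow>
             pair_ends thompson_F (fixing_subgroup thompson_F {0..1/2}) S = \<infinity>)
       \<and> (\<forall>S. finite_generating_set thompson_T S \<longrightarrow>
             pair_ends thompson_T (fixing_subgroup thompson_T (frac ` {0..1/2})) S = \<infinity>)
       \<and> (\<forall>S. finite_generating_set thompson_V S \<longrightarrow>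
             pair_ends thompson_V (fixing_subgroup thompson_V {0..<1/2}) S = \<infinity>)"
  using pair_ends_thompson_F pair_ends_thompson_T pair_ends_thompson_V by blast

end
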